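(* Let $2\le p\leq 4$. Then every minimal pair in $M(p)\times M(p)$ is geodesically non-antipodal. Hence for all $X,Y\in\mathrm{Sym}^+(p)$ for which $|\mathcal{M}(X,Y)|>1$, the non-uniqueness is purely of Type I (i.e. Type I non-uniqueness occurs and Type II non-uniqueness does not occur).
   Context: $\mathrm{Sym}^+(p)$ is the set of $p\times p$ real symmetric positive-definite matrices, $\mathrm{Diag}^+(p)$ the set of $p\times p$ diagonal matrices with positive diagonal entries, $M(p)=SO(p)\times \mathrm{Diag}^+(p)$, $F(U,D)=UDU^T$, and $\mathcal{E}_X=F^{-1}(X)$. $SO(p)$ carries the bi-invariant Riemannian metric $g_{SO}$ given at the identity by $g_{SO}(A_1,A_2)=-\frac12\mathrm{tr}(A_1A_2)$; $\mathrm{Diag}^+(p)$ carries $g_{\mathcal{D}^+}|_D(L_1,L_2)=\mathrm{tr}(D^{-1}L_1D^{-1}L_2)$; $M(p)$ carries $g_M=k\,g_{SO}\oplus g_{\mathcal{D}^+}$ with fixed $k>0$ and distance $d_M$. The scaling-rotation distance is $d_{\mathcal{SR}}(X,Y)=\inf\{d_M(a,b):a\in\mathcal{E}_X,b\in\mathcal{E}_Y\}$. An $F$-minimal geodesic from $\mathcal{E}_X$ to $\mathcal{E}_Y$ is a geodesic $\gamma:[0,1]\to M(p)$ with $\gamma(0)\in\mathcal{E}_X$, $\gamma(1)\in\mathcal{E}_Y$ and length $d_{\mathcal{SR}}(X,Y)$. A minimal pair is a pair $(\gamma(0),\gamma(1))$ for such a $\gamma$ (for some $X,Y$). A minimal smooth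 scaling-rotation (MSSR) curve from $X$ to $Y$ is a curve $F\circ\gamma$ with $\gamma$ an $F$-minimal geodesic from $\mathcal{E}_X$ to $\mathcal{E}_Y$, and $\mathcal{M}(X,Y)$ is the set of these. A pair $((U,D),(V,\Lambda))\in M(p)\times M(p)$ is geodesically antipodal if $V^{-1}U$ is an involution ($R^2=I\ne R$; equivalently, $U$ and $V$ are in each other's cut-locus in $SO(p)$), and geodesically non-antipodal otherwise. Type I non-uniqueness (for $X,Y$): there exist $F$-minimal geodesics $\gamma_1,\gamma_2$ from $\mathcal{E}_X$ to $\mathcal{E}_Y$ with $F\circ\gamma_1\ne F\circ\gamma_2$ whose endpoint pairs are distinct minimal pairs. Type II non-uniqueness: there exist such $\gamma_1,\gamma_2$ with $F\circ\gamma_1\ne F\circ\gamma_2$ whose endpoint pairs are the same minimal pair. *)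

theory Defs
  imports "HOL-Analysis.Analysis"
begin

type_synonym 'n sqmat = "real^'n^'n"

section \<open>The manifold of eigen-decompositions\<close>

definition Sym_pos :: "'n::finite sqmat set"
  where "Sym_pos = {X. transpose X = X \<and> (\<forall>v. v \<noteq> 0 \<longrightarrow> v \<bullet> (X *v v) > 0)}"

definition Diag_pos :: "'n::finite sqmat set"
  where "Diag_pos = {D. (\<forall>i j. i \<noteq> j \<longrightarrow> D $ i $ j = 0) \<and> (\<forall>i. D $ i $ i > 0)}"

definition SO :: "'n::finite sqmat set"
  where "SO = {U. rotation_matrix U}"

definition M :: "('n::finite sqmat \<times> 'n sqmat) set"
  where "M = SO \<times> Diag_pos"

definition F :: "'n::finite sqmat \<times> 'n sqmat \<Rightarrow> 'n sqmat"
  where "F = (\<lambda>(U, D). U ** D ** transpose U)"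

definition fiber :: "'n::finite sqmat \<Rightarrow> ('n sqmat \<times> 'n sqmat) set"
  where "fiber X = {a \<in> M. F a = X}"


section \<open>The Riemannian metric, lengths of curves and the Riemannian distance\<close>

text \<open>Tangent vectors at \<open>U \<in> SO\<close> are represented as matrices \<open>V = U A\<close> with \<open>A\<close>
  skew-symmetric; left translation to the identity (by \<open>U\<^sup>-\<^sup>1\<close>) gives the left-invariant metric
  with value \<open>- tr (A\<^sub>1 A\<^sub>2) / 2\<close> at the identity.  It is also right-invariant, since the trace is
  invariant under conjugation.\<close>

definition g_SO :: "'n::finite sqmat \<Rightarrow> 'n sqmat \<Rightarrow> 'n sqmat \<Rightarrow> real"
  where "g_SO U V1 V2 = - (1/2) * trace ((matrix_inv U ** V1) ** (matrix_inv U ** V2))"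

definition g_Diag :: "'n::finite sqmat \<Rightarrow> 'n sqmat \<Rightarrow> 'n sqmat \<Rightarrow> real"
  where "g_Diag D L1 L2 = trace (matrix_inv D ** L1 ** matrix_inv D ** L2)"

definition g_M ::
    "real \<Rightarrow> 'n::finite sqmat \<times> 'n sqmat \<Rightarrow> 'n sqmat \<times> 'n sqmat \<Rightarrow> 'n sqmat \<times> 'n sqmat \<Rightarrow> real"
  where "g_M k a v w = k * g_SO (fst a) (fst v) (fst w) + g_Diag (snd a) (snd v) (snd w)"

text \<open>Piecewise continuously differentiable in the usual sense: \<open>C\<^sup>1\<close> up to the endpoints on each
  closed interval of a finite partition.  The library predicate \<open>piecewise_C1_differentiable_on\<close>
  would not do here: it allows the derivative to blow up at the break points, so that the speed
  need not be integrable, and the integral of a non-integrable function is \<open>0\<close> by convention.\<close>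

definition piecewise_C1 :: "(real \<Rightarrow> 'a::real_normed_vector) \<Rightarrow> bool"
  where "piecewise_C1 c \<longleftrightarrow>
    (\<exists>(n::nat) x. x 0 = 0 \<and> x n = 1 \<and>
      (\<forall>i<n. x i < x (Suc i) \<and>
        (\<exists>c'. continuous_on {x i .. x (Suc i)} c' \<and>
          (\<forall>t \<in> {x i .. x (Suc i)}.
            (c has_vector_derivative c' t) (at t within {x i .. x (Suc i)})))))"

definition curve_in_M :: "(real \<Rightarrow> 'n::finite sqmat \<times> 'n sqmat) \<Rightarrow> bool"
  where "curve_in_M c \<longleftrightarrow> piecewise_C1 c \<and> (\<forall>t \<in> {0..1}. c t \<in> M)"

text \<open>The integrand is the speed except at the finitely many break points (including \<open>0\<close> and
  \<open>1\<close>), which do not affect the integral.\<close>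

definition curve_length :: "real \<Rightarrow> (real \<Rightarrow> 'n::finite sqmat \<times> 'n sqmat) \<Rightarrow> real"
  where "curve_length k c =
    integral {0..1}
      (\<lambda>t. sqrt (g_M k (c t) (vector_derivative c (at t)) (vector_derivative c (at t))))"

definition dist_M :: "real \<Rightarrow> 'n::finite sqmat \<times> 'n sqmat \<Rightarrow> 'n sqmat \<times> 'n sqmat \<Rightarrow> real"
  where "dist_M k a b = Inf {curve_length k c | c. curve_in_M c \<and> c 0 = a \<and> c 1 = b}"

text \<open>Geodesics parametrised by \<open>[0,1]\<close>: locally length-minimising curves of constant speed \<open>v\<close>
  (constant curves, \<open>v = 0\<close>, included).\<close>

definition geodesic :: "real \<Rightarrow> (real \<Rightarrow> 'n::finite sqmat \<times> 'n sqmat) \<Rightarrow> bool"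
  where "geodesic k \<gamma> \<longleftrightarrow> curve_in_M \<gamma> \<and>
    (\<exists>v\<ge>0. \<forall>t \<in> {0..1}. \<exists>\<epsilon>>0. \<forall>r \<in> {0..1}. \<forall>s \<in> {0..1}.
       \<bar>r - t\<bar> < \<epsilon> \<and> \<bar>s - t\<bar> < \<epsilon> \<longrightarrow> dist_M k (\<gamma> r) (\<gamma> s) = v * \<bar>r - s\<bar>)"


section \<open>Scaling-rotation distance, minimal geodesics and MSSR curves\<close>

definition dist_SR :: "real \<Rightarrow> 'n::finite sqmat \<Rightarrow> 'n sqmat \<Rightarrow> real"
  where "dist_SR k X Y = Inf {dist_M k a b | a b. a \<in> fiber X \<and> b \<in> fiber Y}"

definition F_minimal_geodesic ::
    "real \<Rightarrow> 'n::finite sqmat \<Rightarrow> 'n sqmat \<Rightarrow> (real \<Rightarrow> 'n sqmat \<times> 'n sqmat) \<Rightarrow> bool"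
  where "F_minimal_geodesic k X Y \<gamma> \<longleftrightarrow>
    geodesic k \<gamma> \<and> \<gamma> 0 \<in> fiber X \<and> \<gamma> 1 \<in> fiber Y \<and> curve_length k \<gamma> = dist_SR k X Y"

definition minimal_pair :: "real \<Rightarrow> 'n::finite sqmat \<times> 'n sqmat \<Rightarrow> 'n sqmat \<times> 'n sqmat \<Rightarrow> bool"
  where "minimal_pair k a b \<longleftrightarrow>
    (\<exists>X \<in> Sym_pos. \<exists>Y \<in> Sym_pos. \<exists>\<gamma>. F_minimal_geodesic k X Y \<gamma> \<and> a = \<gamma> 0 \<and> b = \<gamma> 1)"

text \<open>The curve \<open>F \<circ> \<gamma>\<close> with domain \<open>[0,1]\<close>: values outside \<open>[0,1]\<close> are normalised, so that
  HOL-equality of such curves is equality on \<open>[0,1]\<close>.\<close>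

definition SR_curve :: "(real \<Rightarrow> 'n::finite sqmat \<times> 'n sqmat) \<Rightarrow> real \<Rightarrow> 'n sqmat"
  where "SR_curve \<gamma> = restrict (F \<circ> \<gamma>) {0..1}"

definition MSSR :: "real \<Rightarrow> 'n::finite sqmat \<Rightarrow> 'n sqmat \<Rightarrow> (real \<Rightarrow> 'n sqmat) set"
  where "MSSR k X Y = {SR_curve \<gamma> | \<gamma>. F_minimal_geodesic k X Y \<gamma>}"


section \<open>Antipodality and the types of non-uniqueness\<close>

definition is_involution :: "'n::finite sqmat \<Rightarrow> bool"
  where "is_involution R \<longleftrightarrow> R ** R = mat 1 \<and> R \<noteq> mat 1"

definition geodesically_antipodal ::
    "'n::finite sqmat \<times> 'n sqmat \<Rightarrow> 'n sqmat \<times> 'n sqmat \<Rightarrow> bool"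
  where "geodesically_antipodal = (\<lambda>(U, D) (V, \<Lambda>). is_involution (matrix_inv V ** U))"

definition type_I_nonuniqueness :: "real \<Rightarrow> 'n::finite sqmat \<Rightarrow> 'n sqmat \<Rightarrow> bool"
  where "type_I_nonuniqueness k X Y \<longleftrightarrow>
    (\<exists>\<gamma>1 \<gamma>2. F_minimal_geodesic k X Y \<gamma>1 \<and> F_minimal_geodesic k X Y \<gamma>2 \<and>
       SR_curve \<gamma>1 \<noteq> SR_curve \<gamma>2 \<and> (\<gamma>1 0, \<gamma>1 1) \<noteq> (\<gamma>2 0, \<gamma>2 1))"

definition type_II_nonuniqueness :: "real \<Rightarrow> 'n::finite sqmat \<Rightarrow> 'n sqmat \<Rightarrow> bool"
  where "type_II_nonuniqueness k X Y \<longleftrightarrow>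
    (\<exists>\<gamma>1 \<gamma>2. F_minimal_geodesic k X Y \<gamma>1 \<and> F_minimal_geodesic k X Y \<gamma>2 \<and>
       SR_curve \<gamma>1 \<noteq> SR_curve \<gamma>2 \<and> (\<gamma>1 0, \<gamma>1 1) = (\<gamma>2 0, \<gamma>2 1))"

end

theory Submission
  imports Defs
begin

text \<open>Both claims come from one fact: when \<open>2 \<le> p \<le> 4\<close>, the relative rotation
  \<open>Q = U\<^sup>T V\<close> of a minimal pair \<open>((U, D), (V, \<Lambda>))\<close> never has the eigenvalue \<open>-1\<close>.  An involution
  has this eigenvalue, so a minimal pair cannot be antipodal.  Conversely, without this eigenvalue
  the shortest geodesic between the two points is unique, which rules out Type II
  non-uniqueness; two different MSSR curves must then come from different pairs.

  Distances in \<open>M\<close> are controlled by spherical geometry.  The spectral theorem for the symmetric part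
  of \<open>Q\<close> yields an orthonormal frame \<open>e\<close>, the adapted frame, for which the unit vector \<open>e i\<close> is turned
  by \<open>Q\<close> through the angle \<open>\<theta> i = arccos (e i \<bullet> Q e i)\<close>.  A curve in \<open>M\<close> moves each \<open>U e i\<close> along
  the unit sphere and each \<open>ln D j\<close> along the line, and its speed is a weighted Euclidean combination
  of the speeds of these motions.  Hence its length is at least the norm of the displacement vector
  with entries \<open>sqrt (k/2) * \<theta> i\<close> and \<open>ln (\<Lambda> j) - ln (D j)\<close> (\<open>displacement_le_length\<close>).
  If \<open>-1\<close> is not an eigenvalue of \<open>Q\<close>, moving all \<open>U e i\<close> along great circles stays in \<open>SO\<close>
  and attains this bound (\<open>shortest_curve_exists\<close>).

  Suppose that a minimal pair had the eigenvalue \<open>-1\<close>.  For a rotation its multiplicity is even, so two of the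
  angles are \<open>\<pi>\<close> and the rotational part of the squared displacement is at least \<open>k \<pi>\<^sup>2\<close>.  Changing an even
  number of signs of the columns of \<open>U\<close> does not leave the fibre.  The inequality
  \<open>(arccos x)\<^sup>2 \<le> \<pi>\<^sup>2 (1 - x) / 2\<close>, strict for \<open>\<bar>x\<bar> < 1\<close>, bounds the sum of the squared angles of
  a rotation by \<open>\<pi>\<^sup>2 (p - tr Q) / 2\<close>, and the traces of the rotations \<open>S Q\<close>, with \<open>S\<close> an even
  sign change, have average \<open>0 \<ge> p - 4\<close>.  So some \<open>S\<close> brings the rotational part strictly below
  \<open>k \<pi>\<^sup>2\<close>; for \<open>p = 4\<close> it has to be chosen with \<open>tr (S Q) > 0\<close> or with \<open>S Q\<close> not symmetric (\<open>even_sign_flip_near_identity\<close>, \<open>near_identity_angles\<close>), contradicting minimality.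

  For uniqueness, let \<open>\<gamma>\<close> be a minimal geodesic and \<open>z\<close> the displacement of its end points.  Since
  \<open>\<gamma>\<close> has constant speed, the displacements of its two parts have norms at most \<open>t * norm z\<close> and
  \<open>(1 - t) * norm z\<close>, while the triangle inequality on the sphere says that they add up to at
  least \<open>z\<close>.  By strict convexity of the norm they equal \<open>t z\<close> and \<open>(1 - t) z\<close>
  (\<open>F_minimal_geodesic_position\<close>), and a point of the sphere is determined by its angles
  \<open>t \<theta>\<close> and \<open>(1 - t) \<theta>\<close> to two unit vectors enclosing an angle \<open>\<theta> < \<pi>\<close>.\<close>

section \<open>Orthonormal frames and the spectral theorem\<close>

definition orthonormal_frame :: "('n::finite \<Rightarrow> real^'n) \<Rightarrow> bool"
  where "orthonormal_frame e \<longleftrightarrow> (\<forall>i j. e i \<bullet> e j = (if i = j then 1 else 0))"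

lemma frame_inner: "orthonormal_frame e \<Longrightarrow> e i \<bullet> e j = (if i = j then 1 else 0)"
  by (simp add: orthonormal_frame_def)

lemma frame_norm_one: "orthonormal_frame e \<Longrightarrow> norm (e i) = 1"
  by (simp add: orthonormal_frame_def norm_eq_1)

text \<open>The matrix with rows \<open>e i\<close> has a right inverse, its transpose, which is therefore also a
  left inverse.\<close>

lemma frame_complete:
  assumes "orthonormal_frame e"
  shows "(\<Sum>i\<in>UNIV. e i $ a * e i $ b) = (if a = b then 1 else 0)"
proof -
  define E where "E = (\<chi> i. e i)"
  have "E ** transpose E = mat 1"
    using assms by (simp add: E_def matrix_matrix_mult_def transpose_def mat_def vec_eq_iff
        orthonormal_frame_def inner_vec_def)
  then have "transpose E ** E = mat 1"
    by (simp add: matrix_left_right_inverse)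
  then have "(transpose E ** E) $ a $ b = mat 1 $ a $ b" by simp
  then show ?thesis by (simp add: E_def matrix_matrix_mult_def transpose_def mat_def)
qed

lemma frame_expansion:
  assumes "orthonormal_frame e"
  shows "(\<Sum>i\<in>UNIV. (x \<bullet> e i) *\<^sub>R e i) = x"
proof -
  have "(\<Sum>i\<in>UNIV. (x \<bullet> e i) *\<^sub>R e i) $ b = x $ b" for b
  proof -
    have "(\<Sum>i\<in>UNIV. (x \<bullet> e i) *\<^sub>R e i) $ b = (\<Sum>i\<in>UNIV. \<Sum>a\<in>UNIV. x $ a * (e i $ a * e i $ b))"
      by (simp add: inner_vec_def sum_distrib_right mult.assoc)
    also have "\<dots> = (\<Sum>a\<in>UNIV. x $ a * (\<Sum>i\<in>UNIV. e i $ a * e i $ b))"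
      by (subst sum.swap) (simp add: sum_distrib_left)
    also have "\<dots> = x $ b"
      by (simp add: frame_complete[OF assms] if_distrib cong: if_cong)
    finally show ?thesis .
  qed
  then show ?thesis by (simp add: vec_eq_iff)
qed

lemma frame_trace:
  assumes "orthonormal_frame e"
  shows "(\<Sum>i\<in>UNIV. e i \<bullet> (A *v e i)) = trace A"
proof -
  have "(\<Sum>i\<in>UNIV. e i \<bullet> (A *v e i))
      = (\<Sum>i\<in>UNIV. \<Sum>a\<in>UNIV. \<Sum>b\<in>UNIV. A $ a $ b * (e i $ a * e i $ b))"
    by (simp add: inner_vec_def matrix_vector_mult_def sum_distrib_left mult_ac)
  also have "\<dots> = (\<Sum>a\<in>UNIV. \<Sum>b\<in>UNIV. A $ a $ b * (\<Sum>i\<in>UNIV. e i $ a * e i $ b))"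
    by (subst sum.swap, rule sum.cong[OF refl], subst sum.swap) (simp add: sum_distrib_left)
  also have "\<dots> = trace A"
    by (simp add: frame_complete[OF assms] trace_def if_distrib cong: if_cong)
  finally show ?thesis .
qed

lemma norm_matrix_square: "(norm (A :: 'n::finite sqmat))\<^sup>2 = trace (transpose A ** A)"
proof -
  have "(norm A)\<^sup>2 = (\<Sum>i\<in>UNIV. \<Sum>j\<in>UNIV. A $ i $ j * A $ i $ j)"
    by (simp add: power2_norm_eq_inner inner_vec_def)
  also have "\<dots> = trace (transpose A ** A)"
    by (subst sum.swap) (simp add: trace_def matrix_matrix_mult_def transpose_def)
  finally show ?thesis .
qed

lemma frame_norm_matrix:
  assumes "orthonormal_frame e"
  shows "(\<Sum>i\<in>UNIV. (norm (A *v e i))\<^sup>2) = (norm (A :: 'n::finite sqmat))\<^sup>2"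
proof -
  have "(norm (A *v e i))\<^sup>2 = e i \<bullet> ((transpose A ** A) *v e i)" for i
    by (simp add: power2_norm_eq_inner dot_lmul_matrix vector_transpose_matrix
        flip: matrix_vector_mul_assoc) (metis dot_lmul_matrix vector_transpose_matrix inner_commute transpose_transpose)
  then show ?thesis
    by (simp add: frame_trace[OF assms] norm_matrix_square)
qed

lemma frame_matrix_eqI:
  assumes "orthonormal_frame e" and "\<And>i. A *v e i = B *v e i"
  shows "A = (B :: 'n::finite sqmat)"
proof -
  have "(norm (A - B))\<^sup>2 = 0"
    using assms(2) by (simp add: frame_norm_matrix[OF assms(1), symmetric] matrix_vector_mult_diff_rdistrib)
  then show ?thesis by simp
qed

lemma transpose_move: "x \<bullet> (A *v y) = (transpose A *v x) \<bullet> (y :: real^'n::finite)"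
  by (metis dot_lmul_matrix transpose_matrix_vector)

lemma orthogonal_inner:
  assumes "orthogonal_matrix (U :: 'n::finite sqmat)"
  shows "(U *v x) \<bullet> (U *v y) = x \<bullet> y"
  using assms by (simp add: transpose_move matrix_vector_mul_assoc orthogonal_matrix_def)

text \<open>The quadratic form of \<open>f\<close> attains its maximum on the compact unit sphere of \<open>S\<close>; a
  maximiser is an eigenvector.\<close>

lemma symmetric_max_eigenvector:
  fixes f :: "'a::euclidean_space \<Rightarrow> 'a"
  assumes lin: "linear f" and sym: "\<And>x y. f x \<bullet> y = x \<bullet> f y"
    and S: "subspace S" and inv: "\<And>x. x \<in> S \<Longrightarrow> f x \<in> S" and ne: "S \<noteq> {0}"
  obtains e c where "e \<in> S" "norm e = 1" "f e = c *\<^sub>R e"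
proof -
  let ?K = "S \<inter> sphere 0 1"
  have "compact ?K"
    by (simp add: closed_Int_compact closed_subspace S)
  moreover have "?K \<noteq> {}"
  proof -
    obtain x where "x \<in> S" "x \<noteq> 0" using ne subspace_0[OF S] by blast
    then have "x /\<^sub>R norm x \<in> ?K" by (simp add: subspace_scale[OF S])
    then show ?thesis by blast
  qed
  moreover have "continuous_on ?K (\<lambda>x. x \<bullet> f x)"
    by (intro continuous_intros linear_continuous_on) (simp add: lin linear_conv_bounded_linear[symmetric])
  ultimately have "\<exists>e\<in>?K. \<forall>x\<in>?K. x \<bullet> f x \<le> e \<bullet> f e"
    by (rule continuous_attains_sup)
  then obtain e where e: "e \<in> ?K" and mx: "\<And>x. x \<in> ?K \<Longrightarrow> x \<bullet> f x \<le> e \<bullet> f e"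
    by blast
  define m where "m = e \<bullet> f e"
  \<comment> \<open>The form \<open>g\<close> is positive semidefinite on \<open>S\<close> and vanishes at \<open>e\<close>, so \<open>e\<close> is in its kernel.\<close>
  define g where "g x = m * (x \<bullet> x) - x \<bullet> f x" for x
  have "norm e = 1" using e by simp
  then have ee: "e \<bullet> e = 1" by (metis norm_eq_1)
  have g_nonneg: "g x \<ge> 0" if "x \<in> S" for x
  proof (cases "x = 0")
    case True
    then show ?thesis by (simp add: g_def)
  next
    case False
    have "x /\<^sub>R norm x \<in> ?K" using that False by (simp add: subspace_scale[OF S])
    from mx[OF this] have "(x \<bullet> f x) / (norm x)\<^sup>2 \<le> m"
      by (simp add: m_def linear_scale[OF lin] power2_eq_square divide_inverse mult_ac)
    then show ?thesis using False by (simp add: g_def field_simps power2_norm_eq_inner)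
  qed
  define w where "w = m *\<^sub>R e - f e"
  have wS: "w \<in> S" using e by (simp add: w_def S inv subspace_diff subspace_scale)
  have expand: "g (e + s *\<^sub>R w) = 2 * s * (norm w)\<^sup>2 + s\<^sup>2 * g w" for s
  proof -
    have 1: "w \<bullet> f e = e \<bullet> f w" by (metis sym inner_commute)
    have 2: "(norm w)\<^sup>2 = m * (e \<bullet> w) - f e \<bullet> w"
      unfolding power2_norm_eq_inner by (subst w_def) (simp add: inner_diff_left)
    have 3: "f e \<bullet> w = e \<bullet> f w" by (rule sym)
    have 4: "g (e + s *\<^sub>R w) = m * (e \<bullet> e) - e \<bullet> f e + 2 * s * (m * (e \<bullet> w) - e \<bullet> f w) + s\<^sup>2 * g w"
      by (simp add: g_def linear_add[OF lin] linear_scale[OF lin] inner_add_left inner_add_right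
          1 inner_commute[of w e] algebra_simps power2_eq_square)
    show ?thesis using 4 2 3 ee by (simp add: m_def)
  qed
  have "w = 0"
  proof (rule ccontr)
    assume "w \<noteq> 0"
    then have nw: "(norm w)\<^sup>2 > 0" by simp
    have gw: "g w \<ge> 0" using wS g_nonneg by blast
    \<comment> \<open>A negative step so small that the linear term outweighs the quadratic one.\<close>
    define s where "s = - (norm w)\<^sup>2 / (g w + 1)"
    have "g (e + s *\<^sub>R w) \<ge> 0"
      using g_nonneg e wS by (simp add: S subspace_add subspace_scale)
    then have *: "0 \<le> s * (2 * (norm w)\<^sup>2 + s * g w)"
      by (simp add: expand power2_eq_square algebra_simps)
    have "s < 0" using nw gw by (simp add: s_def divide_neg_pos)
    moreover have "2 * (norm w)\<^sup>2 + s * g w > 0"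
    proof -
      have "(norm w)\<^sup>2 * g w \<le> (norm w)\<^sup>2 * (g w + 1)" by (simp add: mult_left_mono)
      then have "- s * g w \<le> (norm w)\<^sup>2" using gw by (simp add: s_def field_simps)
      then show ?thesis using nw by linarith
    qed
    ultimately show False using * using mult_neg_pos[of s] by fastforce
  qed
  then have "f e = m *\<^sub>R e" by (simp add: w_def)
  then show thesis using that e by auto
qed

text \<open>Induction on the dimension: split off one eigenvector and continue in its orthogonal
  complement, which \<open>f\<close> preserves by self-adjointness.\<close>

lemma symmetric_eigenbasis:
  fixes f :: "'a::euclidean_space \<Rightarrow> 'a"
  assumes lin: "linear f" and sym: "\<And>x y. f x \<bullet> y = x \<bullet> f y"
    and S: "subspace S" and inv: "\<And>x. x \<in> S \<Longrightarrow> f x \<in> S"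
  shows "\<exists>B. B \<subseteq> S \<and> finite B \<and> card B = dim S \<and> pairwise orthogonal B \<and>
    (\<forall>b\<in>B. norm b = 1 \<and> (\<exists>c. f b = c *\<^sub>R b))"
  using S inv
proof (induction "dim S" arbitrary: S)
  case 0
  then show ?case by (intro exI[of _ "{}"]) auto
next
  case (Suc n)
  then have "S \<noteq> {0}" by auto
  then obtain e c where e: "e \<in> S" "norm e = 1" "f e = c *\<^sub>R e"
    using symmetric_max_eigenvector[OF lin sym Suc.prems(1) Suc.prems(2)] by blast
  define T where "T = {x \<in> S. e \<bullet> x = 0}"
  have T_eq: "T = {y \<in> S. \<forall>x\<in>span {e}. orthogonal x y}"
    by (auto simp: T_def orthogonal_def span_singleton)
  have "dim {y \<in> S. \<forall>x\<in>span {e}. orthogonal x y} + dim (span {e}) = dim S"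
    by (rule dim_subspace_orthogonal_to_vectors) (use e Suc.prems in \<open>auto simp: span_minimal\<close>)
  moreover have "e \<noteq> 0" using e by auto
  ultimately have dimT: "dim T = n" using Suc.hyps(2) by (simp add: T_eq dim_singleton)
  have subT: "subspace T"
    unfolding T_def using Suc.prems(1) by (auto simp: subspace_def inner_add_right)
  have invT: "f x \<in> T" if "x \<in> T" for x
    using that Suc.prems(2) by (auto simp: T_def e(3) simp flip: sym)
  obtain B where B: "B \<subseteq> T" "finite B" "card B = dim T" "pairwise orthogonal B"
      "\<forall>b\<in>B. norm b = 1 \<and> (\<exists>c. f b = c *\<^sub>R b)"
    using Suc.hyps(1)[OF dimT[symmetric] subT invT] by blast
  have "e \<notin> B" using B(1) e(2) by (auto simp: T_def dot_square_norm)
  have orth: "orthogonal e b" "orthogonal b e" if "b \<in> B" for b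
    using that B(1) by (auto simp: T_def orthogonal_def inner_commute)
  have "insert e B \<subseteq> S" using B(1) e(1) by (auto simp: T_def)
  moreover have "card (insert e B) = dim S"
    using B(2,3) \<open>e \<notin> B\<close> dimT Suc.hyps(2) by simp
  moreover have "pairwise orthogonal (insert e B)"
    using B(4) orth by (simp add: pairwise_insert)
  moreover have "\<forall>b\<in>insert e B. norm b = 1 \<and> (\<exists>c. f b = c *\<^sub>R b)"
    using B(5) e by blast
  ultimately show ?case using B(2) by blast
qed

lemma symmetric_matrix_eigenframe:
  assumes "transpose H = (H :: 'n::finite sqmat)"
  obtains e :: "'n \<Rightarrow> real^'n" where "orthonormal_frame e" "\<And>i. H *v e i = (e i \<bullet> (H *v e i)) *\<^sub>R e i"
proof -
  have "(H *v x) \<bullet> y = x \<bullet> (H *v y)" for x y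
    using transpose_move[of x H y] assms by simp
  then obtain B where B: "finite B" "card B = dim (UNIV :: (real^'n) set)" "pairwise orthogonal B"
     "\<forall>b\<in>B. norm b = 1 \<and> (\<exists>c. H *v b = c *\<^sub>R b)"
    using symmetric_eigenbasis[of "(*v) H" UNIV] by (auto simp: matrix_vector_mul_linear)
  then have "card B = CARD('n)" by simp
  then obtain e where e: "bij_betw e (UNIV :: 'n set) B"
    using B(1) by (metis finite_same_card_bij finite)
  have fr: "orthonormal_frame e"
    unfolding orthonormal_frame_def
  proof (intro allI)
    fix i j
    have "e i \<in> B" "e j \<in> B" using e by (auto simp: bij_betw_def)
    moreover have "e i = e j \<longleftrightarrow> i = j" using e by (auto simp: bij_betw_def inj_on_def)
    ultimately show "e i \<bullet> e j = (if i = j then 1 else 0)"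
      using B by (auto simp: pairwise_def orthogonal_def dot_square_norm)
  qed
  moreover have "H *v e i = (e i \<bullet> (H *v e i)) *\<^sub>R e i" for i
  proof -
    have "e i \<in> B" using e by (auto simp: bij_betw_def)
    then obtain c where "H *v e i = c *\<^sub>R e i" using B by blast
    then show ?thesis by (simp add: frame_inner[OF fr])
  qed
  ultimately show thesis using that by blast
qed


section \<open>Rotations and the frames adapted to them\<close>

text \<open>A frame adapted to \<open>Q\<close> diagonalises the symmetric part \<open>(Q + Q\<^sup>T) / 2\<close>.  For a rotation
  \<open>Q\<close> it is a real substitute for a basis of complex eigenvectors: the span of \<open>e i\<close> and
  \<open>Q e i\<close> is invariant, and \<open>Q\<close> turns it by the angle whose cosine is the eigenvalue
  \<open>e i \<bullet> Q e i\<close>.\<close>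

definition adapted_frame :: "'n::finite sqmat \<Rightarrow> ('n \<Rightarrow> real^'n) \<Rightarrow> bool"
  where "adapted_frame Q e \<longleftrightarrow> orthonormal_frame e \<and>
    (\<forall>i. Q *v e i + transpose Q *v e i = (2 * (e i \<bullet> (Q *v e i))) *\<^sub>R e i)"

lemma adapted_frame_exists:
  fixes Q :: "'n::finite sqmat"
  obtains e where "adapted_frame Q e"
proof -
  have "transpose (Q + transpose Q) = Q + transpose Q"
    by (simp add: transpose_def vec_eq_iff add.commute)
  then obtain e :: "'n \<Rightarrow> real^'n" where e: "orthonormal_frame e"
      "\<And>i. (Q + transpose Q) *v e i = (e i \<bullet> ((Q + transpose Q) *v e i)) *\<^sub>R e i"
    using symmetric_matrix_eigenframe by blast
  have "e i \<bullet> ((Q + transpose Q) *v e i) = 2 * (e i \<bullet> (Q *v e i))" for i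
    using transpose_move[of "e i" "transpose Q" "e i"]
    by (simp add: matrix_vector_mult_add_rdistrib inner_add_right inner_commute)
  then have "adapted_frame Q e"
    using e by (simp add: adapted_frame_def matrix_vector_mult_add_rdistrib)
  then show thesis using that by blast
qed

lemma orthogonal_norm:
  "orthogonal_matrix (U :: 'n::finite sqmat) \<Longrightarrow> norm (U *v x) = norm x"
  by (simp add: norm_eq_sqrt_inner orthogonal_inner)

lemma matrix_vector_minus: "A *v (- x) = - (A *v (x :: real^'n::finite))"
  by (rule linear_neg[OF matrix_vector_mul_linear])

lemma cos_bound:
  fixes Q :: "'n::finite sqmat"
  assumes "orthogonal_matrix Q" "norm x = 1"
  shows "\<bar>x \<bullet> (Q *v x)\<bar> \<le> 1"
proof -
  have "norm (Q *v x) = 1"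
    using assms by (simp add: orthogonal_norm)
  then show ?thesis using Cauchy_Schwarz_ineq2[of x "Q *v x"] assms(2) by simp
qed

lemma unit_inner_one_imp_eq:
  fixes x y :: "'a::real_inner"
  assumes "norm x = 1" "norm y = 1" "x \<bullet> y = 1"
  shows "x = y"
proof -
  have "(norm (x - y))\<^sup>2 = 0"
    using assms by (simp add: power2_norm_eq_inner inner_diff inner_commute) (simp flip: power2_norm_eq_inner)
  then show ?thesis by simp
qed

lemma unit_inner_minus_one_imp_eq:
  fixes x y :: "'a::real_inner"
  assumes "norm x = 1" "norm y = 1" "x \<bullet> y = - 1"
  shows "y = - x"
  using unit_inner_one_imp_eq[of "- x" y] assms by simp

text \<open>From \<open>C\<^sup>T (C + 1) = (C + 1)\<^sup>T\<close> the determinant \<open>d\<close> of \<open>C + 1\<close> satisfies \<open>- d = d\<close>.\<close>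

lemma minus_det_imp_minus_eigenvector:
  fixes C :: "'n::finite sqmat"
  assumes C: "orthogonal_matrix C" and d: "det C = - 1"
  obtains w where "w \<noteq> 0" "C *v w = - w"
proof -
  have "transpose C ** (C + mat 1) = transpose (C + mat 1)"
    using C by (simp add: orthogonal_matrix_def matrix_add_ldistrib)
       (simp add: transpose_def mat_def vec_eq_iff)
  then have "det (transpose C) * det (C + mat 1) = det (C + mat 1)"
    by (metis det_mul det_transpose)
  then have "det (C + mat 1) = 0" using d by simp
  then have "\<not> inj ((*v) (C + mat 1))"
    using det_nz_iff_inj[of "(*v) (C + mat 1)"] by (simp add: matrix_vector_mul_linear)
  then obtain w where "w \<noteq> 0" "(C + mat 1) *v w = 0"
    using linear_injective_0[of "(*v) (C + mat 1)"] by (auto simp: matrix_vector_mul_linear)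
  then show thesis
    using that[of w] by (simp add: matrix_vector_mult_add_rdistrib eq_neg_iff_add_eq_0)
qed

text \<open>The eigenvalue \<open>-1\<close> of a rotation has even multiplicity.  Composing \<open>Q\<close> with the
  reflection in the hyperplane orthogonal to \<open>e i\<close> makes the determinant \<open>-1\<close> and turns \<open>e i\<close> into a fixed
  vector.  A \<open>-1\<close> eigenvector of the composition is orthogonal to \<open>e i\<close>, so it is not affected by
  the reflection and is also one of \<open>Q\<close>.\<close>

lemma rotation_second_minus_eigenvector:
  fixes Q :: "'n::finite sqmat"
  assumes Q: "rotation_matrix Q" and e: "orthonormal_frame e" and ei: "Q *v e i = - e i"
  obtains f where "f \<noteq> 0" "f \<bullet> e i = 0" "Q *v f = - f"
proof -
  define P where "P = transpose (\<chi> a. e a)"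
  define D :: "'n sqmat" where "D = (\<chi> a b. if a = b then if a = i then - 1 else 1 else 0)"
  have P: "orthogonal_matrix P"
    using e by (simp add: P_def orthogonal_matrix matrix_matrix_mult_def transpose_def mat_def
        vec_eq_iff orthonormal_frame_def inner_vec_def)
  have D: "orthogonal_matrix D"
    by (auto simp: D_def orthogonal_matrix matrix_matrix_mult_def transpose_def mat_def
        vec_eq_iff if_distrib[of "\<lambda>x. x * _"] if_distrib[of "\<lambda>x. _ * x"] cong: if_cong)
  have detD: "det D = - 1"
  proof -
    have "det D = (\<Prod>a\<in>UNIV. D $ a $ a)"
      by (rule det_diagonal) (simp add: D_def)
    also have "\<dots> = - 1"
      by (simp add: D_def prod.If_cases)
    finally show ?thesis .
  qed
  \<comment> \<open>The reflection in the hyperplane orthogonal to \<open>e i\<close>.\<close>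
  define S where "S = P ** D ** transpose P"
  have S_orth: "orthogonal_matrix S"
    unfolding S_def by (intro orthogonal_matrix_mul P D) (simp add: P)
  have PiP: "det P * det P = 1"
    using det_orthogonal_matrix[OF P] by auto
  have "det S = - 1"
    using PiP by (simp add: S_def det_mul detD)
  then have detC: "det (Q ** S) = - 1" using Q by (simp add: det_mul rotation_matrix_def)
  have C: "orthogonal_matrix (Q ** S)"
    using Q S_orth by (simp add: rotation_matrix_def orthogonal_matrix_mul)
  obtain w where w: "w \<noteq> 0" "(Q ** S) *v w = - w"
    using minus_det_imp_minus_eigenvector[OF C detC] .
  have tP: "(transpose P *v x) $ a = e a \<bullet> x" for x a
    by (simp add: P_def matrix_vector_mult_def inner_vec_def)
  have Px: "P *v x = (\<Sum>a\<in>UNIV. (x $ a) *\<^sub>R e a)" for x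
    by (simp add: P_def matrix_vector_mult_def transpose_def vec_eq_iff mult.commute)
  have Dx: "D *v x = (\<chi> a. if a = i then - x $ a else x $ a)" for x
    by (simp add: D_def matrix_vector_mult_def vec_eq_iff if_distrib[of "\<lambda>x. x * _"] cong: if_cong)
  have Sx: "S *v x = (\<Sum>a\<in>UNIV. (if a = i then - (e a \<bullet> x) else e a \<bullet> x) *\<^sub>R e a)" for x
    unfolding S_def by (simp add: Px Dx tP del: transpose_matrix_vector flip: matrix_vector_mul_assoc cong: if_cong)
  have "S *v e i = (\<Sum>a\<in>UNIV. if a = i then - e i else 0)"
    unfolding Sx by (intro sum.cong) (auto simp: frame_inner[OF e])
  then have Sei: "S *v e i = - e i" by simp
  have "w \<bullet> e i = ((Q ** S) *v w) \<bullet> ((Q ** S) *v e i)"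
    by (rule orthogonal_inner[OF C, symmetric])
  also have "\<dots> = - (w \<bullet> e i)"
    unfolding w(2) by (simp add: Sei ei matrix_vector_minus flip: matrix_vector_mul_assoc)
  finally have we: "w \<bullet> e i = 0" by simp
  have "S *v w = (\<Sum>a\<in>UNIV. (w \<bullet> e a) *\<^sub>R e a)"
    unfolding Sx using we by (intro sum.cong) (auto simp: inner_commute)
  then have "S *v w = w" by (simp add: frame_expansion[OF e])
  then have "Q *v w = - w" using w(2) by (simp flip: matrix_vector_mul_assoc)
  then show thesis using that w(1) we by blast
qed

text \<open>A \<open>-1\<close> eigenvector is also one of the symmetric part, hence it has a component along
  some \<open>e i\<close> whose eigenvalue is \<open>-1\<close>.  This is applied to \<open>v\<close> and then to a second
  eigenvector orthogonal to the axis found first.\<close>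

lemma rotation_minus_eigenvector_two_axes:
  fixes Q :: "'n::finite sqmat"
  assumes Q: "rotation_matrix Q" and e: "adapted_frame Q e" and v: "v \<noteq> 0" "Q *v v = - v"
  obtains i j where "i \<noteq> j" "e i \<bullet> (Q *v e i) = - 1" "e j \<bullet> (Q *v e j) = - 1"
proof -
  have fr: "orthonormal_frame e" using e by (simp add: adapted_frame_def)
  have orth: "orthogonal_matrix Q" using Q by (simp add: rotation_matrix_def)
  have *: "\<exists>i. v \<bullet> e i \<noteq> 0 \<and> e i \<bullet> (Q *v e i) = - 1" if v: "v \<noteq> 0" "Q *v v = - v" for v
  proof -
    have "\<exists>i. v \<bullet> e i \<noteq> 0"
    proof (rule ccontr)
      assume "\<not> ?thesis"
      then have "v = 0" using frame_expansion[OF fr, of v] by simp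
      then show False using v by simp
    qed
    then obtain i where i: "v \<bullet> e i \<noteq> 0" by blast
    have "transpose Q *v (Q *v v) = v"
      using orth by (simp add: orthogonal_matrix_def matrix_vector_mul_assoc)
    then have tv: "transpose Q *v v = - v"
      unfolding v(2) matrix_vector_minus by (metis minus_minus)
    have "(2 * (e i \<bullet> (Q *v e i))) * (v \<bullet> e i) = v \<bullet> (Q *v e i + transpose Q *v e i)"
      using e by (simp add: adapted_frame_def)
    also have "\<dots> = (transpose Q *v v) \<bullet> e i + (Q *v v) \<bullet> e i"
      unfolding inner_add_right
      by (metis transpose_move transpose_transpose)
    also have "\<dots> = - 2 * (v \<bullet> e i)"
      unfolding tv v(2) by simp
    finally have eq: "(2 * (e i \<bullet> (Q *v e i))) * (v \<bullet> e i) = - 2 * (v \<bullet> e i)" .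
    have "2 * (e i \<bullet> (Q *v e i)) = - 2" by (rule mult_right_cancel[THEN iffD1, OF i eq])
    then have "e i \<bullet> (Q *v e i) = - 1" by linarith
    then show ?thesis using i by blast
  qed
  obtain i where i: "e i \<bullet> (Q *v e i) = - 1" using *[OF v] by blast
  have "Q *v e i = - e i"
    by (rule unit_inner_minus_one_imp_eq[OF _ _ i]) (auto simp: frame_norm_one[OF fr] orthogonal_norm[OF orth])
  then obtain f where f: "f \<noteq> 0" "f \<bullet> e i = 0" "Q *v f = - f"
    using rotation_second_minus_eigenvector[OF Q fr] by blast
  obtain j where "f \<bullet> e j \<noteq> 0" "e j \<bullet> (Q *v e j) = - 1" using *[OF f(1,3)] by blast
  then show thesis using that[of i j] i f(2) by auto
qed

section \<open>Angles between unit vectors\<close>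

text \<open>The difference vanishes at \<open>0\<close> and \<open>\<pi>/2\<close> and has a decreasing derivative; a zero or
  negative value in between would force, by the mean value theorem, a nonpositive value of the derivative before a
  nonnegative one.\<close>

lemma jordan_strict:
  assumes "0 < y" "y < pi / 2"
  shows "2 / pi * y < sin y"
proof (rule ccontr)
  assume neg: "\<not> ?thesis"
  define f where "f t = sin t - 2 / pi * t" for t :: real
  have fy: "f y \<le> 0" using neg by (simp add: f_def)
  have der: "(f has_real_derivative cos t - 2 / pi) (at t)" for t
    unfolding f_def by (auto intro!: derivative_eq_intros)
  obtain a where a: "0 < a" "a < y" "f y - f 0 = (y - 0) * (cos a - 2 / pi)"
    using MVT2[of 0 y f "\<lambda>t. cos t - 2 / pi"] assms der by blast
  obtain b where b: "y < b" "b < pi / 2" "f (pi/2) - f y = (pi / 2 - y) * (cos b - 2 / pi)"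
    using MVT2[of y "pi/2" f "\<lambda>t. cos t - 2 / pi"] assms der by blast
  have "f 0 = 0" "f (pi/2) = 0" by (simp_all add: f_def)
  then have "y * (cos a - 2 / pi) \<le> 0" "(pi / 2 - y) * (cos b - 2 / pi) \<ge> 0"
    using a(3) b(3) fy by auto
  then have "cos a - 2 / pi \<le> 0" "cos b - 2 / pi \<ge> 0"
    using assms by (auto simp: mult_le_0_iff zero_le_mult_iff)
  moreover have "cos b < cos a"
    using a b assms by (intro cos_monotone_0_pi) auto
  ultimately show False by linarith
qed

lemma half_angle_arccos:
  assumes "\<bar>x\<bar> \<le> 1"
  shows "1 - x = 2 * (sin (arccos x / 2))\<^sup>2"
proof -
  have "x = cos (2 * (arccos x / 2))" using assms by (simp add: cos_arccos)
  also have "\<dots> = 1 - 2 * (sin (arccos x / 2))\<^sup>2" by (rule cos_double_sin)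
  finally show ?thesis by linarith
qed

text \<open>With \<open>\<theta> = arccos x\<close> the right-hand side is \<open>(\<pi> sin (\<theta>/2))\<^sup>2\<close>, so this is Jordan's inequality at
  \<open>\<theta>/2\<close>.  The bound is the chord through the end points of the convex function \<open>(arccos x)\<^sup>2\<close>; being
  linear in \<open>x\<close>, it turns sums of squared angles into traces.\<close>

lemma arccos_square_strict:
  assumes "\<bar>x\<bar> < 1"
  shows "(arccos x)\<^sup>2 < pi\<^sup>2 / 2 * (1 - x)"
proof -
  have ac: "0 < arccos x" "arccos x < pi" using assms arccos_lt_bounded[of x] by auto
  then have "2 / pi * (arccos x / 2) < sin (arccos x / 2)" by (intro jordan_strict) auto
  then have "arccos x < pi * sin (arccos x / 2)" by (simp add: field_simps)
  then have "(arccos x)\<^sup>2 < (pi * sin (arccos x / 2))\<^sup>2"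
    using ac by (intro power_strict_mono) auto
  also have "\<dots> = pi\<^sup>2 / 2 * (1 - x)"
    using half_angle_arccos[of x] assms by (simp add: power_mult_distrib)
  finally show ?thesis .
qed

lemma arccos_square_le:
  assumes "\<bar>x\<bar> \<le> 1"
  shows "(arccos x)\<^sup>2 \<le> pi\<^sup>2 / 2 * (1 - x)"
proof -
  consider "\<bar>x\<bar> < 1" | "x = 1" | "x = - 1" using assms by linarith
  then show ?thesis
    by cases (use arccos_square_strict[of x] in auto)
qed

lemma chord_le_arccos:
  assumes "\<bar>x\<bar> \<le> 1"
  shows "2 - 2 * x \<le> (arccos x)\<^sup>2"
proof -
  have ac: "0 \<le> arccos x" "arccos x \<le> pi" using assms arccos_bounded[of x] by auto
  then have "sin (arccos x / 2) \<le> arccos x / 2" by (intro sin_x_le_x) auto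
  moreover have "0 \<le> sin (arccos x / 2)" using ac by (intro sin_ge_zero) auto
  ultimately have "(sin (arccos x / 2))\<^sup>2 \<le> (arccos x / 2)\<^sup>2" by (intro power_mono)
  then show ?thesis using half_angle_arccos[OF assms] by (simp add: power_divide)
qed

lemma unit_inner_bound: "norm x = 1 \<Longrightarrow> norm y = 1 \<Longrightarrow> \<bar>x \<bullet> y\<bar> \<le> (1 :: real)"
  using Cauchy_Schwarz_ineq2[of x y] by simp

lemma sphere_triangle:
  fixes x y z :: "'a::real_inner"
  assumes "norm x = 1" "norm y = 1" "norm z = 1"
  shows "arccos (x \<bullet> z) \<le> arccos (x \<bullet> y) + arccos (y \<bullet> z)"
proof (cases "arccos (x \<bullet> y) + arccos (y \<bullet> z) \<le> pi")
  case False
  then show ?thesis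
    using arccos_ubound[of "x \<bullet> z"] unit_inner_bound[of x z] assms by (simp add: abs_le_iff)
next
  case True
  define p q where "p = x \<bullet> y" and "q = y \<bullet> z"
  have pq: "\<bar>p\<bar> \<le> 1" "\<bar>q\<bar> \<le> 1"
    using unit_inner_bound assms by (auto simp: p_def q_def)
  have xx: "x \<bullet> x = 1" "y \<bullet> y = 1" "z \<bullet> z = 1" using assms by (metis norm_eq_1)+
  \<comment> \<open>Cauchy--Schwarz for the components of \<open>x\<close> and \<open>z\<close> orthogonal to \<open>y\<close>.\<close>
  have nx: "norm (x - p *\<^sub>R y) = sqrt (1 - p\<^sup>2)"
    by (simp add: norm_eq_sqrt_inner inner_diff xx inner_commute[of y x] power2_eq_square flip: p_def)
  have nz: "norm (z - q *\<^sub>R y) = sqrt (1 - q\<^sup>2)"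
    by (simp add: norm_eq_sqrt_inner inner_diff xx inner_commute[of z y] power2_eq_square flip: q_def)
  have "(x - p *\<^sub>R y) \<bullet> (z - q *\<^sub>R y) = x \<bullet> z - p * q"
    by (simp add: inner_diff xx flip: p_def q_def)
  then have "\<bar>x \<bullet> z - p * q\<bar> \<le> sqrt (1 - p\<^sup>2) * sqrt (1 - q\<^sup>2)"
    using Cauchy_Schwarz_ineq2[of "x - p *\<^sub>R y" "z - q *\<^sub>R y"] nx nz by simp
  then have "x \<bullet> z \<ge> p * q - sqrt (1 - p\<^sup>2) * sqrt (1 - q\<^sup>2)" by linarith
  then have "cos (arccos p + arccos q) \<le> x \<bullet> z"
    using pq by (simp add: cos_add cos_arccos_abs sin_arccos_abs)
  then have "arccos (x \<bullet> z) \<le> arccos (cos (arccos p + arccos q))"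
    using unit_inner_bound[of x z] assms
    by (intro arccos_le_arccos) (auto simp: abs_le_iff)
  also have "\<dots> = arccos p + arccos q"
    using True arccos_lbound[of p] arccos_lbound[of q] pq
    by (intro arccos_cos) (auto simp: p_def q_def abs_le_iff)
  finally show ?thesis by (simp add: p_def q_def)
qed

text \<open>A point at angles \<open>t \<theta>\<close> and \<open>(1 - t) \<theta>\<close> from two unit vectors enclosing the angle \<open>\<theta>\<close> is
  the spherical linear interpolation between them: the difference of the two sides has norm \<open>0\<close> by
  the addition theorems.\<close>

lemma slerp:
  fixes x y z :: "'a::real_inner"
  assumes n: "norm x = 1" "norm y = 1" "norm z = 1"
    and a: "x \<bullet> z = cos \<theta>" "x \<bullet> y = cos (t * \<theta>)" "y \<bullet> z = cos ((1 - t) * \<theta>)"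
  shows "sin \<theta> *\<^sub>R y = sin ((1 - t) * \<theta>) *\<^sub>R x + sin (t * \<theta>) *\<^sub>R z"
proof -
  define u v where "u = t * \<theta>" and "v = (1 - t) * \<theta>"
  have uv: "\<theta> = u + v" by (simp add: u_def v_def algebra_simps)
  have xx: "x \<bullet> x = 1" "y \<bullet> y = 1" "z \<bullet> z = 1" using n by (metis norm_eq_1)+
  have xz: "x \<bullet> z = cos u * cos v - sin u * sin v"
    using a(1) by (simp add: uv cos_add)
  have xy: "x \<bullet> y = cos u" and yz: "y \<bullet> z = cos v"
    using a(2,3) by (simp_all add: u_def v_def)
  let ?w = "sin \<theta> *\<^sub>R y - sin v *\<^sub>R x - sin u *\<^sub>R z"
  have "?w \<bullet> ?w = (sin \<theta>)\<^sup>2 + (sin v)\<^sup>2 + (sin u)\<^sup>2 - 2 * sin \<theta> * sin v * (x \<bullet> y)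
      - 2 * sin \<theta> * sin u * (y \<bullet> z) + 2 * sin v * sin u * (x \<bullet> z)"
    by (simp add: inner_diff xx inner_commute[of y x] inner_commute[of z x] inner_commute[of z y]
        algebra_simps power2_eq_square)
  also have "\<dots> = 0"
  proof -
    have s: "(sin u)\<^sup>2 = 1 - (cos u)\<^sup>2" "(sin v)\<^sup>2 = 1 - (cos v)\<^sup>2" by (simp_all add: sin_squared_eq)
    have "(sin u * cos v + cos u * sin v)\<^sup>2 + (sin v)\<^sup>2 + (sin u)\<^sup>2
      - 2 * (sin u * cos v + cos u * sin v) * sin v * cos u
      - 2 * (sin u * cos v + cos u * sin v) * sin u * cos v
      + 2 * sin v * sin u * (cos u * cos v - sin u * sin v)
      = (sin v)\<^sup>2 + (sin u)\<^sup>2 - (sin u)\<^sup>2 * (cos v)\<^sup>2 - (cos u)\<^sup>2 * (sin v)\<^sup>2 - 2 * (sin u)\<^sup>2 * (sin v)\<^sup>2"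
      by (simp add: algebra_simps power2_eq_square)
    also have "\<dots> = 0" unfolding s by (simp add: algebra_simps)
    finally show ?thesis by (simp add: uv sin_add xy yz xz)
  qed
  finally have "?w = 0" by simp
  then show ?thesis by (simp add: u_def v_def algebra_simps)
qed

lemma slerp_unique:
  fixes x y y' z :: "'a::real_inner"
  assumes "norm x = 1" "norm y = 1" "norm y' = 1" "norm z = 1"
    and \<theta>: "0 \<le> \<theta>" "\<theta> < pi" and "x \<bullet> z = cos \<theta>"
    and "x \<bullet> y = cos (t * \<theta>)" "y \<bullet> z = cos ((1 - t) * \<theta>)"
    and "x \<bullet> y' = cos (t * \<theta>)" "y' \<bullet> z = cos ((1 - t) * \<theta>)"
  shows "y = y'"
proof (cases "\<theta> = 0")
  case True
  then have "x = y" "x = y'"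
    using assms by (auto intro: unit_inner_one_imp_eq)
  then show ?thesis by simp
next
  case False
  then have "sin \<theta> \<noteq> 0" using \<theta> sin_gt_zero[of \<theta>] by simp
  moreover have "sin \<theta> *\<^sub>R y = sin \<theta> *\<^sub>R y'"
    using slerp[of x y z \<theta> t] slerp[of x y' z \<theta> t] assms by simp
  ultimately show ?thesis by simp
qed

section \<open>Even sign changes and near-identity rotations\<close>

definition sign_flip :: "'n set \<Rightarrow> 'n::finite sqmat"
  where "sign_flip J = (\<chi> a b. if a = b then (if a \<in> J then - 1 else 1) else 0)"

lemma transpose_sign_flip: "transpose (sign_flip J) = sign_flip J"
  by (auto simp: sign_flip_def transpose_def vec_eq_iff)

lemma sign_flip_mult_nth:
  "(sign_flip J ** A) $ a $ b = (if a \<in> J then - (A $ a $ b) else A $ a $ b)"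
  by (simp add: sign_flip_def matrix_matrix_mult_def if_distrib[of "\<lambda>x. x * _"] cong: if_cong)

lemma mult_sign_flip_nth:
  "(A ** sign_flip J) $ a $ b = (if b \<in> J then - (A $ a $ b) else A $ a $ b)"
  by (simp add: sign_flip_def matrix_matrix_mult_def if_distrib[of "\<lambda>x. _ * x"] cong: if_cong)

lemma sign_flip_rotation:
  assumes "even (card J)"
  shows "rotation_matrix (sign_flip J :: 'n::finite sqmat)"
proof -
  have "det (sign_flip J :: 'n sqmat) = (\<Prod>a\<in>UNIV. sign_flip J $ a $ a)"
    by (rule det_diagonal) (simp add: sign_flip_def)
  also have "\<dots> = 1"
    using assms by (simp add: sign_flip_def prod.If_cases)
  finally have "det (sign_flip J :: 'n sqmat) = 1" .
  moreover have "sign_flip J ** sign_flip J = (mat 1 :: 'n sqmat)"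
    by (simp add: vec_eq_iff sign_flip_mult_nth) (simp add: sign_flip_def mat_def)
  ultimately show ?thesis
    by (simp add: rotation_matrix_def orthogonal_matrix transpose_sign_flip)
qed

lemma sign_flip_conj_diagonal:
  assumes "D \<in> Diag_pos"
  shows "sign_flip J ** D ** sign_flip J = D"
proof -
  have "D $ a $ b = 0" if "a \<noteq> b" for a b using assms that by (simp add: Diag_pos_def)
  then show ?thesis
    by (simp add: vec_eq_iff mult_sign_flip_nth sign_flip_mult_nth) metis
qed

lemma trace_sign_flip:
  "trace (sign_flip J ** A) = trace A - 2 * (\<Sum>a\<in>J. A $ a $ a)" for A :: "'n::finite sqmat"
proof -
  have "trace (sign_flip J ** A) = (\<Sum>a\<in>UNIV. A $ a $ a - 2 * (if a \<in> J then A $ a $ a else 0))"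
    unfolding trace_def by (intro sum.cong) (auto simp: sign_flip_mult_nth)
  then show ?thesis
    by (simp add: sum_subtractf trace_def sum.If_cases flip: sum_distrib_left)
qed

lemma card_four_obtain:
  assumes "card A = 4"
  obtains a b c d where "A = {a, b, c, d}" "distinct [a, b, c, d]"
proof -
  have "finite A" using assms by (metis card.infinite zero_neq_numeral)
  then obtain xs where xs: "set xs = A" "distinct xs" using finite_distinct_list by blast
  then have "length xs = 4" using assms distinct_card by fastforce
  then obtain a b c d where "xs = [a, b, c, d]"
    by (auto simp: numeral_eq_Suc length_Suc_conv)
  then show thesis using that xs by auto
qed

text \<open>A trace criterion for the sum of the squared angles of a rotation \<open>Q\<close> to be below
  \<open>2 \<pi>\<^sup>2\<close>, that is, for a distance less than \<open>\<pi>\<close> from the identity in the metric of \<open>SO\<close>.  In the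
  boundary case the estimate of the angles is still strict unless all angles are \<open>0\<close> or \<open>\<pi>\<close>, which for
  an orthogonal matrix means symmetry.\<close>

definition near_identity :: "'n::finite sqmat \<Rightarrow> bool"
  where "near_identity Q \<longleftrightarrow> trace Q > real CARD('n) - 4 \<or>
    (trace Q = real CARD('n) - 4 \<and> transpose Q \<noteq> Q)"

text \<open>An averaging argument.  The traces of the matrices obtained by even sign changes have
  mean \<open>0\<close>, which exceeds \<open>p - 4\<close> for \<open>p = 2\<close> and \<open>p = 3\<close>.  For \<open>p = 4\<close> the only way to have no
  positive trace is a zero diagonal; if in addition all sign changes of \<open>R\<close> were symmetric, then \<open>R\<close>
  would commute with all of them, hence be diagonal, hence vanish.\<close>

lemma even_sign_flip_near_identity:
  fixes R :: "'n::finite sqmat"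
  assumes R: "R \<noteq> 0" and card: "2 \<le> CARD('n)" "CARD('n) \<le> 4"
  obtains J where "even (card J)" "near_identity (sign_flip J ** R)"
proof (rule ccontr)
  assume "\<not> thesis"
  with that have neg: "\<not> near_identity (sign_flip J ** R)" if "even (card J)" for J
    using that by blast
  have le: "trace R - 2 * (\<Sum>a\<in>J. R $ a $ a) \<le> real CARD('n) - 4" if "even (card J)" for J
    using neg[OF that] by (auto simp: near_identity_def trace_sign_flip)
  have two: "trace R - 2 * (R $ a $ a + R $ b $ b) \<le> real CARD('n) - 4" if "a \<noteq> b" for a b
    using le[of "{a, b}"] that by simp
  have zero: "trace R \<le> real CARD('n) - 4" using le[of "{}"] by simp
  consider "CARD('n) = 2" | "CARD('n) = 3" | "CARD('n) = 4" using card by linarith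
  then show False
  proof cases
    case 1
    then obtain a b :: 'n where ab: "UNIV = {a, b}" "a \<noteq> b" by (auto simp: card_2_iff)
    then have "trace R = R $ a $ a + R $ b $ b" by (simp add: trace_def ab(1))
    then show False using two[OF ab(2)] zero 1 by simp
  next
    case 2
    then obtain a b c :: 'n where abc: "UNIV = {a, b, c}" "a \<noteq> b" "b \<noteq> c" "a \<noteq> c"
      by (auto simp: card_3_iff)
    then have "trace R = R $ a $ a + R $ b $ b + R $ c $ c" by (simp add: trace_def abc(1))
    then show False using two[of a b] two[of b c] two[of a c] abc zero 2 by simp
  next
    case 3
    then obtain a b c d :: 'n where abcd: "UNIV = {a, b, c, d}" "distinct [a, b, c, d]"
      using card_four_obtain[of "UNIV :: 'n set"] by blast
    then have tr: "trace R = R $ a $ a + R $ b $ b + R $ c $ c + R $ d $ d" by (simp add: trace_def abcd(1))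
    have "trace R - 2 * trace R \<le> 0"
      using le[of UNIV] 3 by (simp add: trace_def)
    then have tr0: "trace R = 0" using zero 3 by simp
    have "R $ a $ a + R $ b $ b \<ge> 0" "R $ a $ a + R $ c $ c \<ge> 0" "R $ a $ a + R $ d $ d \<ge> 0"
      "R $ b $ b + R $ c $ c \<ge> 0" "R $ b $ b + R $ d $ d \<ge> 0" "R $ c $ c + R $ d $ d \<ge> 0"
      using two[of a b] two[of a c] two[of a d] two[of b c] two[of b d] two[of c d] abcd tr0 3
      by simp_all
    then have "R $ a $ a = 0" "R $ b $ b = 0" "R $ c $ c = 0" "R $ d $ d = 0"
      using tr0 tr by linarith+
    then have "\<forall>x\<in>UNIV. R $ x $ x = 0" unfolding abcd(1) by simp
    then have diag: "R $ x $ x = 0" for x by blast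
    have sym: "transpose (sign_flip J ** R) = sign_flip J ** R" if "even (card J)" for J
      using neg[OF that] tr0 3 by (simp add: near_identity_def trace_sign_flip diag)
    have R_sym: "R $ x $ y = R $ y $ x" for x y
    proof -
      have "transpose (sign_flip {} ** R) $ x $ y = (sign_flip {} ** R) $ x $ y"
        by (subst sym) auto
      then show ?thesis by (simp add: transpose_def sign_flip_mult_nth)
    qed
    have "R $ x $ y = 0" for x y
    proof (cases "x = y")
      case True
      then show ?thesis by (simp add: diag)
    next
      case False
      have "card {x, y} < CARD('n)" using False 3 by simp
      then have "{x, y} \<noteq> UNIV" by (metis less_irrefl)
      then obtain z where z: "z \<noteq> x" "z \<noteq> y" by blast
      have "transpose (sign_flip {x, z} ** R) $ x $ y = (sign_flip {x, z} ** R) $ x $ y"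
        by (subst sym) (use z in auto)
      then have "R $ y $ x = - (R $ x $ y)"
        using z False by (simp add: transpose_def sign_flip_mult_nth)
      then show ?thesis using R_sym[of x y] by linarith
    qed
    then show False using R by (simp add: vec_eq_iff)
  qed
qed

lemma extreme_angles_imp_symmetric:
  fixes Q :: "'n::finite sqmat"
  assumes orth: "orthogonal_matrix Q" and e: "adapted_frame Q e"
    and "\<And>k. e k \<bullet> (Q *v e k) = 1 \<or> e k \<bullet> (Q *v e k) = - 1"
  shows "transpose Q = Q"
proof -
  have fr: "orthonormal_frame e" using e by (simp add: adapted_frame_def)
  define x where "x i = e i \<bullet> (Q *v e i)" for i
  have pm: "x k = 1 \<or> x k = - 1" for k using assms(3) by (simp add: x_def)
  have nQ: "norm (Q *v e k) = 1" for k
    by (simp add: orthogonal_norm[OF orth] frame_norm_one[OF fr])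
  have "Q *v e k = x k *\<^sub>R e k" for k
    using pm[of k] unit_inner_one_imp_eq[OF frame_norm_one[OF fr] nQ, of k k]
      unit_inner_minus_one_imp_eq[OF frame_norm_one[OF fr] nQ, of k k]
    unfolding x_def by fastforce
  moreover have "Q *v e k + transpose Q *v e k = (2 * x k) *\<^sub>R e k" for k
    using e by (simp add: adapted_frame_def x_def)
  ultimately have "transpose Q *v e k = Q *v e k" for k
    by (metis add_left_cancel mult_2 scaleR_add_left)
  then show ?thesis using frame_matrix_eqI[OF fr] by blast
qed

text \<open>An eigenvalue \<open>-1\<close> has multiplicity at least two, so that the trace is at most
  \<open>(p - 2) - 2\<close>, with equality only if all other eigenvalues of the symmetric part are \<open>1\<close>.\<close>

lemma near_identity_no_minus_eigenvector:
  fixes Q :: "'n::finite sqmat"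
  assumes Q: "rotation_matrix Q" and near: "near_identity Q" and v: "v \<noteq> 0"
  shows "Q *v v \<noteq> - v"
proof
  assume Qv: "Q *v v = - v"
  obtain e where e: "adapted_frame Q e" using adapted_frame_exists .
  have fr: "orthonormal_frame e" using e by (simp add: adapted_frame_def)
  have orth: "orthogonal_matrix Q" using Q by (simp add: rotation_matrix_def)
  define x where "x i = e i \<bullet> (Q *v e i)" for i
  obtain i j where ij: "i \<noteq> j" "x i = - 1" "x j = - 1"
    using rotation_minus_eigenvector_two_axes[OF Q e v Qv] unfolding x_def by blast
  have x1: "\<bar>x k\<bar> \<le> 1" for k unfolding x_def using cos_bound[OF orth frame_norm_one[OF fr]] .
  have tr: "trace Q = sum x UNIV" by (simp add: x_def frame_trace[OF fr])
  have split: "sum x UNIV = sum x (UNIV - {i, j}) - 2"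
    using ij by (subst sum.subset_diff[of "{i, j}"]) auto
  have cardij: "real (card (UNIV - {i, j})) = real CARD('n) - 2"
  proof -
    have "card {i, j} \<le> CARD('n)" by (intro card_mono) auto
    then show ?thesis using ij by (simp add: card_Diff_subset of_nat_diff)
  qed
  have le: "sum x (UNIV - {i, j}) \<le> real CARD('n) - 2"
    using sum_bounded_above[of "UNIV - {i, j}" x 1] x1 cardij by (auto simp: abs_le_iff)
  then have eq: "trace Q = real CARD('n) - 4" and ns: "transpose Q \<noteq> Q"
    using near tr split by (auto simp: near_identity_def)
  have "(\<Sum>k\<in>UNIV - {i, j}. 1 - x k) = 0"
    using eq tr split cardij by (simp add: sum_subtractf)
  then have "\<forall>k\<in>UNIV - {i, j}. 1 - x k = 0"
    using x1 by (subst (asm) sum_nonneg_eq_0_iff) (auto simp: abs_le_iff)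
  then have pm: "x k = 1 \<or> x k = - 1" for k using ij by auto
  have "transpose Q = Q"
    using extreme_angles_imp_symmetric[OF orth e] pm unfolding x_def by blast
  then show False using ns by simp
qed

text \<open>Summing \<open>(arccos x)\<^sup>2 \<le> \<pi>\<^sup>2 (1 - x) / 2\<close> over the axes gives the bound
  \<open>\<pi>\<^sup>2 (p - tr Q) / 2\<close>.\<close>

lemma near_identity_angles:
  fixes Q :: "'n::finite sqmat"
  assumes Q: "rotation_matrix Q" and near: "near_identity Q" and e: "adapted_frame Q e"
  shows "(\<Sum>i\<in>UNIV. (arccos (e i \<bullet> (Q *v e i)))\<^sup>2) < 2 * pi\<^sup>2"
proof -
  have fr: "orthonormal_frame e" using e by (simp add: adapted_frame_def)
  have orth: "orthogonal_matrix Q" using Q by (simp add: rotation_matrix_def)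
  define x where "x i = e i \<bullet> (Q *v e i)" for i
  have x1: "\<bar>x k\<bar> \<le> 1" for k unfolding x_def using cos_bound[OF orth frame_norm_one[OF fr]] .
  have tr: "trace Q = sum x UNIV" by (simp add: x_def frame_trace[OF fr])
  have sum: "(\<Sum>i\<in>UNIV. pi\<^sup>2 / 2 * (1 - x i)) = pi\<^sup>2 / 2 * (real CARD('n) - trace Q)"
    by (simp only: tr sum_distrib_left[symmetric]) (simp add: sum_subtractf)
  have "(\<Sum>i\<in>UNIV. (arccos (x i))\<^sup>2) < 2 * pi\<^sup>2"
  proof (cases "trace Q > real CARD('n) - 4")
    case True
    have "(\<Sum>i\<in>UNIV. (arccos (x i))\<^sup>2) \<le> (\<Sum>i\<in>UNIV. pi\<^sup>2 / 2 * (1 - x i))"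
      by (intro sum_mono arccos_square_le x1)
    also have "\<dots> < pi\<^sup>2 / 2 * 4"
      unfolding sum using True by (intro mult_strict_left_mono) auto
    finally show ?thesis by simp
  next
    case False
    then have eq: "trace Q = real CARD('n) - 4" and ns: "transpose Q \<noteq> Q"
      using near by (auto simp: near_identity_def)
    have "\<exists>k. \<bar>x k\<bar> < 1"
    proof (rule ccontr)
      assume "\<not> ?thesis"
      then have not_lt: "\<not> \<bar>x k\<bar> < 1" for k by blast
      have pm: "x k = 1 \<or> x k = - 1" for k
        using x1[of k] not_lt[of k] by linarith
      have "transpose Q = Q"
        using extreme_angles_imp_symmetric[OF orth e] pm unfolding x_def by blast
      then show False using ns by simp
    qed
    then obtain k where k: "\<bar>x k\<bar> < 1" by blast
    have "(\<Sum>i\<in>UNIV. (arccos (x i))\<^sup>2) < (\<Sum>i\<in>UNIV. pi\<^sup>2 / 2 * (1 - x i))"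
      using arccos_square_le[OF x1] arccos_square_strict[OF k]
      by (intro sum_strict_mono_ex1[OF finite]) blast+
    also have "\<dots> = 2 * pi\<^sup>2" unfolding sum eq by simp
    finally show ?thesis .
  qed
  then show ?thesis by (simp add: x_def)
qed

section \<open>The speed of a curve in \<open>M\<close>\<close>

text \<open>The Riemannian norm of a tangent vector of \<open>M\<close>, written with the Frobenius norm of the
  rotational part and the logarithmic derivatives of the diagonal part.\<close>

definition tangent_norm ::
    "real \<Rightarrow> 'n::finite sqmat \<times> 'n sqmat \<Rightarrow> 'n sqmat \<times> 'n sqmat \<Rightarrow> real"
  where "tangent_norm k a v =
    sqrt (k / 2 * (norm (fst v))\<^sup>2 + (\<Sum>j\<in>UNIV. (snd v $ j $ j / snd a $ j $ j)\<^sup>2))"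

lemma tangent_norm_nonneg: "k \<ge> 0 \<Longrightarrow> tangent_norm k a v \<ge> 0"
  by (simp add: tangent_norm_def sum_nonneg)

lemma matrix_inv_unique:
  assumes "A ** B = mat 1" "B ** A = mat 1"
  shows "matrix_inv (A :: 'n::finite sqmat) = B"
proof -
  have "A ** matrix_inv A = mat 1 \<and> matrix_inv A ** A = mat 1"
    unfolding matrix_inv_def by (rule someI[of _ B]) (use assms in blast)
  then show ?thesis by (metis assms(2) matrix_mul_assoc matrix_mul_lid matrix_mul_rid)
qed

lemma matrix_inv_orthogonal: "orthogonal_matrix U \<Longrightarrow> matrix_inv U = transpose (U :: 'n::finite sqmat)"
  by (rule matrix_inv_unique) (simp_all add: orthogonal_matrix_def)

lemma matrix_inv_Diag_pos:
  assumes "D \<in> Diag_pos"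
  shows "matrix_inv D = (\<chi> i j. if i = j then 1 / D $ i $ i else 0)"
proof -
  have off: "D $ i $ j = 0" if "i \<noteq> j" for i j using assms that by (simp add: Diag_pos_def)
  have D: "D = (\<chi> i j. if i = j then D $ i $ i else 0)"
    by (simp add: vec_eq_iff off)
  have pos: "D $ i $ i \<noteq> 0" for i
  proof -
    have "D $ i $ i > 0" using assms by (simp add: Diag_pos_def)
    then show ?thesis by simp
  qed
  show ?thesis
    by (rule matrix_inv_unique; subst D)
       (auto simp: matrix_matrix_mult_def vec_eq_iff mat_def pos if_distrib[of "\<lambda>x. x * _"]
          if_distrib[of "\<lambda>x. _ * x"] cong: if_cong)
qed

lemma frame_axis: "orthonormal_frame (\<lambda>i. axis i 1)"
  by (simp add: orthonormal_frame_def inner_axis_axis)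

lemma norm_orthogonal_mult:
  assumes "orthogonal_matrix U"
  shows "norm (U ** A) = norm (A :: 'n::finite sqmat)"
proof -
  have "(norm (U ** A))\<^sup>2 = (norm A)\<^sup>2"
    by (simp add: frame_norm_matrix[OF frame_axis, symmetric] orthogonal_norm[OF assms]
        flip: matrix_vector_mul_assoc)
  then show ?thesis by simp
qed

lemma g_M_eq_tangent_norm:
  assumes U: "orthogonal_matrix U" and skew: "transpose (transpose U ** U') = - (transpose U ** U')"
    and D: "D \<in> Diag_pos" and D': "\<And>i j. i \<noteq> j \<Longrightarrow> D' $ i $ j = 0"
  shows "sqrt (g_M k (U, D) (U', D') (U', D')) = tangent_norm k (U, D) (U', D')"
proof -
  let ?A = "transpose U ** U'"
  have "(norm U')\<^sup>2 = (norm ?A)\<^sup>2"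
    using norm_orthogonal_mult[of "transpose U" U'] U by simp
  also have "\<dots> = trace (- ?A ** ?A)"
    unfolding norm_matrix_square skew ..
  also have "\<dots> = - trace (?A ** ?A)"
  proof -
    have "- ?A ** ?A = - (?A ** ?A)"
      by (simp add: matrix_matrix_mult_def vec_eq_iff sum_negf)
    then show ?thesis by (simp add: trace_def sum_negf)
  qed
  finally have so: "g_SO U U' U' = (norm U')\<^sup>2 / 2"
    by (simp add: g_SO_def matrix_inv_orthogonal[OF U])
  have inv: "matrix_inv D ** D' = (\<chi> i j. if i = j then D' $ i $ i / D $ i $ i else 0)"
    unfolding matrix_inv_Diag_pos[OF D]
    by (auto simp: matrix_matrix_mult_def vec_eq_iff D' if_distrib[of "\<lambda>x. x * _"] cong: if_cong)
  have "g_Diag D D' D' = trace ((matrix_inv D ** D') ** (matrix_inv D ** D'))"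
    by (simp add: g_Diag_def matrix_mul_assoc)
  also have "\<dots> = (\<Sum>j\<in>UNIV. (D' $ j $ j / D $ j $ j)\<^sup>2)"
    unfolding inv by (simp add: trace_def matrix_matrix_mult_def power2_eq_square
        if_distrib[of "\<lambda>x. x * _"] cong: if_cong)
  finally show ?thesis by (simp add: g_M_def so tangent_norm_def)
qed

lemma bounded_linear_mult_vec: "bounded_linear (\<lambda>A :: 'n::finite sqmat. A *v x)"
  by (intro linear_conv_bounded_linear[THEN iffD1] linearI)
     (simp_all add: matrix_vector_mult_add_rdistrib scaleR_matrix_vector_assoc)

lemma bounded_linear_entry: "bounded_linear (\<lambda>A :: 'n::finite sqmat. A $ i $ j)"
  by (intro linear_conv_bounded_linear[THEN iffD1] linearI) simp_all

lemma in_M_D: "a \<in> M \<Longrightarrow> orthogonal_matrix (fst a) \<and> det (fst a) = 1 \<and> snd a \<in> Diag_pos"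
  by (auto simp: M_def SO_def rotation_matrix_def)

lemma derivative_of_constant:
  fixes f :: "real \<Rightarrow> real"
  assumes "(f has_real_derivative d) (at t)" "t \<in> {0<..<1}" "\<And>s. s \<in> {0..1} \<Longrightarrow> f s = c"
  shows "d = 0"
proof -
  have "((\<lambda>_. c) has_real_derivative d) (at t)"
    by (rule has_field_derivative_transform_within_open[OF assms(1) open_greaterThanLessThan assms(2)])
       (use assms(3) in auto)
  then show ?thesis using DERIV_const DERIV_unique by blast
qed

text \<open>Differentiate the equations \<open>(U x) \<bullet> (U y) = x \<bullet> y\<close> and \<open>D i j = 0\<close>, which hold along
  the curve.\<close>

lemma velocity_tangent:
  assumes c: "\<And>t. t \<in> {0..1} \<Longrightarrow> c t \<in> M" and t: "t \<in> {0<..<1}"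
    and der: "(c has_vector_derivative v) (at t)"
  shows "transpose (transpose (fst (c t)) ** fst v) = - (transpose (fst (c t)) ** fst v)"
    and "i \<noteq> j \<Longrightarrow> snd v $ i $ j = 0"
    and "(fst v *v x) \<bullet> (fst (c t) *v x) = 0"
proof -
  have dU: "((\<lambda>s. fst (c s) *v x) has_vector_derivative fst v *v x) (at t)" for x
    using bounded_linear.has_vector_derivative[OF bounded_linear_compose[OF bounded_linear_mult_vec bounded_linear_fst] der] by simp
  have dD: "((\<lambda>s. snd (c s) $ i $ j) has_vector_derivative snd v $ i $ j) (at t)" for i j
    using bounded_linear.has_vector_derivative[OF bounded_linear_compose[OF bounded_linear_entry bounded_linear_snd] der] by simp
  have skew: "(fst (c t) *v x) \<bullet> (fst v *v y) + (fst v *v x) \<bullet> (fst (c t) *v y) = 0" for x y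
  proof (rule derivative_of_constant[OF _ t])
    show "((\<lambda>s. (fst (c s) *v x) \<bullet> (fst (c s) *v y)) has_real_derivative
        (fst (c t) *v x) \<bullet> (fst v *v y) + (fst v *v x) \<bullet> (fst (c t) *v y)) (at t)"
      unfolding has_real_derivative_iff_has_vector_derivative
      by (rule bounded_bilinear.has_vector_derivative[OF bounded_bilinear_inner dU dU])
    show "(fst (c s) *v x) \<bullet> (fst (c s) *v y) = x \<bullet> y" if "s \<in> {0..1}" for s
      using in_M_D[OF c[OF that]] by (simp add: orthogonal_inner)
  qed
  show "(fst v *v x) \<bullet> (fst (c t) *v x) = 0"
    using skew[of x x] by (simp add: inner_commute)
  let ?A = "transpose (fst (c t)) ** fst v"
  have A: "?A $ i $ j = (fst (c t) *v axis i 1) \<bullet> (fst v *v axis j 1)" for i j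
    by (simp add: matrix_vector_mult_basis column_def inner_vec_def matrix_matrix_mult_def transpose_def)
  have "transpose ?A $ i $ j = (- ?A) $ i $ j" for i j
  proof -
    have "transpose ?A $ i $ j = ?A $ j $ i" by (simp add: transpose_def)
    also have "\<dots> = - (?A $ i $ j)"
      unfolding A using skew[of "axis j 1" "axis i 1"]
      by (simp add: inner_commute[of "fst v *v axis j 1"] eq_neg_iff_add_eq_0)
    finally show ?thesis by simp
  qed
  then show "transpose ?A = - ?A" unfolding vec_eq_iff by blast
  show "snd v $ i $ j = 0" if "i \<noteq> j"
  proof (rule derivative_of_constant[OF _ t])
    show "((\<lambda>s. snd (c s) $ i $ j) has_real_derivative snd v $ i $ j) (at t)"
      using dD by (simp add: has_real_derivative_iff_has_vector_derivative)
    show "snd (c s) $ i $ j = 0" if "s \<in> {0..1}" for s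
      using in_M_D[OF c[OF that]] \<open>i \<noteq> j\<close> by (simp add: Diag_pos_def)
  qed
qed

text \<open>What piecewise \<open>C\<^sup>1\<close> is needed for: apart from finitely many parameters the curve is
  differentiable, and its speed is integrable because on each piece it agrees, up to the end points,
  with a continuous function.\<close>

lemma curve_regular:
  fixes c :: "real \<Rightarrow> 'n::finite sqmat \<times> 'n sqmat"
  assumes c: "curve_in_M c"
  obtains K where "finite K" "continuous_on {0..1} c"
    "\<And>t. t \<in> {0<..<1} - K \<Longrightarrow> (c has_vector_derivative vector_derivative c (at t)) (at t)"
    "(\<lambda>t. tangent_norm k (c t) (vector_derivative c (at t))) integrable_on {0..1}"
proof -
  obtain n :: nat and x where x: "x 0 = 0" "x n = 1" and
    step_lt: "\<And>i. i < n \<Longrightarrow> x i < x (Suc i)" and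
    pieces: "\<And>i. i < n \<Longrightarrow> \<exists>c'. continuous_on {x i .. x (Suc i)} c' \<and>
          (\<forall>t \<in> {x i .. x (Suc i)}. (c has_vector_derivative c' t) (at t within {x i .. x (Suc i)}))"
    using c unfolding curve_in_M_def piecewise_C1_def by blast
  have mono: "x i \<le> x j" if "i \<le> j" "j \<le> n" for i j
    using that
  proof (induction j rule: dec_induct)
    case (step m)
    then show ?case using step_lt[of m] by simp
  qed simp
  let ?\<sigma> = "\<lambda>t. tangent_norm k (c t) (vector_derivative c (at t))"
  have "\<exists>K. finite K \<and> continuous_on {0..x m} c \<and>
      (\<forall>t\<in>{0<..<x m} - K. (c has_vector_derivative vector_derivative c (at t)) (at t)) \<and>
      ?\<sigma> integrable_on {0..x m}" if "m \<le> n" for m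
    using that
  proof (induction m)
    case 0
    have "?\<sigma> integrable_on {0}" using integrable_on_refl[of ?\<sigma> 0] by simp
    then show ?case using x by (intro exI[of _ "{}"]) auto
  next
    case (Suc m)
    from Suc.IH[OF Suc_leD[OF Suc.prems]] obtain K where K: "finite K" "continuous_on {0..x m} c"
      "\<And>t. t\<in>{0<..<x m} - K \<Longrightarrow> (c has_vector_derivative vector_derivative c (at t)) (at t)"
      "?\<sigma> integrable_on {0..x m}" by blast
    have m: "m < n" using Suc.prems by simp
    obtain c' where c': "continuous_on {x m .. x (Suc m)} c'"
      "\<And>t. t \<in> {x m .. x (Suc m)} \<Longrightarrow> (c has_vector_derivative c' t) (at t within {x m .. x (Suc m)})"
      using pieces[OF m] by blast
    have bounds: "0 \<le> x m" "x (Suc m) \<le> 1" "x m < x (Suc m)"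
      using mono[of 0 m] mono[of "Suc m" n] step_lt[OF m] m x by auto
    have cont: "continuous_on {x m .. x (Suc m)} c"
      unfolding continuous_on_eq_continuous_within
      using c'(2) has_vector_derivative_continuous by blast
    have int: "(c has_vector_derivative c' t) (at t)" if "t \<in> {x m <..< x (Suc m)}" for t
    proof -
      have "(c has_vector_derivative c' t) (at t within {x m <..< x (Suc m)})"
        by (rule has_vector_derivative_within_subset[OF c'(2)]) (use that in auto)
      then show ?thesis by (simp only: has_vector_derivative_within_open[OF that open_greaterThanLessThan])
    qed
    have pos: "snd (c t) $ j $ j \<noteq> 0" if "t \<in> {x m .. x (Suc m)}" for t j
    proof -
      have "c t \<in> M" using c that bounds by (auto simp: curve_in_M_def)
      then have "snd (c t) $ j $ j > 0" using in_M_D[of "c t"] by (simp add: Diag_pos_def)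
      then show ?thesis by simp
    qed
    have "continuous_on {x m .. x (Suc m)} (\<lambda>t. tangent_norm k (c t) (c' t))"
      unfolding tangent_norm_def
      by (intro continuous_intros continuous_on_component cont c'(1) continuous_on_fst continuous_on_snd) (use pos in auto)
    then have "(\<lambda>t. tangent_norm k (c t) (c' t)) integrable_on {x m .. x (Suc m)}"
      by (rule integrable_continuous_real)
    moreover have "?\<sigma> t = tangent_norm k (c t) (c' t)" if "t \<in> {x m <..< x (Suc m)}" for t
      using vector_derivative_at[OF int[OF that]] by simp
    ultimately have "?\<sigma> integrable_on {x m .. x (Suc m)}"
      using integrable_spike_interior[of "x m" "x (Suc m)" ?\<sigma>] by simp
    then have i: "?\<sigma> integrable_on {0 .. x (Suc m)}"
      using Henstock_Kurzweil_Integration.integrable_combine[of 0 "x m" "x (Suc m)" ?\<sigma>] K(4) bounds by auto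
    have "{0 .. x (Suc m)} = {0 .. x m} \<union> {x m .. x (Suc m)}" using bounds by auto
    then have cc: "continuous_on {0..x (Suc m)} c"
      using continuous_on_closed_Un[OF _ _ K(2) cont] by simp
    have "(c has_vector_derivative vector_derivative c (at t)) (at t)"
      if "t \<in> {0<..<x (Suc m)} - insert (x m) K" for t
    proof (cases "t < x m")
      case True
      then show ?thesis using K(3) that by auto
    next
      case False
      then have "t \<in> {x m <..< x (Suc m)}" using that by auto
      from int[OF this] show ?thesis by (simp add: vector_derivative_at)
    qed
    then show ?case using K(1) cc i by (intro exI[of _ "insert (x m) K"]) auto
  qed
  from this[of n] x obtain K where "finite K" "continuous_on {0..1} c"
      "\<forall>t\<in>{0<..<1} - K. (c has_vector_derivative vector_derivative c (at t)) (at t)"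
      "?\<sigma> integrable_on {0..1}"
    by auto
  then show thesis using that by blast
qed

lemma curve_length_eq:
  assumes c: "curve_in_M c"
  shows "curve_length k c = integral {0..1} (\<lambda>t. tangent_norm k (c t) (vector_derivative c (at t)))"
proof -
  obtain K where K: "finite K"
    "\<And>t. t \<in> {0<..<1} - K \<Longrightarrow> (c has_vector_derivative vector_derivative c (at t)) (at t)"
    using curve_regular[OF c, of k] by blast
  have M: "\<And>t. t \<in> {0..1} \<Longrightarrow> c t \<in> M" using c by (simp add: curve_in_M_def)
  show ?thesis
    unfolding curve_length_def
  proof (rule integral_spike[of "insert 0 (insert 1 K)"])
    show "negligible (insert 0 (insert 1 K))" using K(1) by (intro negligible_finite) simp
    fix t :: real assume "t \<in> {0..1} - insert 0 (insert 1 K)"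
    then have t: "t \<in> {0<..<1}" "t \<in> {0<..<1} - K" by auto
    note v = velocity_tangent[OF M t(1) K(2)[OF t(2)]]
    have "orthogonal_matrix (fst (c t))" "snd (c t) \<in> Diag_pos" using in_M_D[OF M] t by simp_all
    then show "tangent_norm k (c t) (vector_derivative c (at t)) =
        sqrt (g_M k (c t) (vector_derivative c (at t)) (vector_derivative c (at t)))"
      using g_M_eq_tangent_norm[OF _ v(1), of "snd (c t)" "snd (vector_derivative c (at t))" k] v(2)
      by simp
  qed
qed

section \<open>A lower bound for the length of a curve\<close>

text \<open>The angles through which the frame vectors move between two points of \<open>M\<close>, and the changes
  of the logarithms of the diagonal entries, scaled so that the Euclidean norm is comparable
  with Riemannian length.\<close>

definition displacement ::
    "real \<Rightarrow> ('n \<Rightarrow> real^'n) \<Rightarrow> 'n::finite sqmat \<times> 'n sqmat \<Rightarrow> 'n sqmat \<times> 'n sqmat \<Rightarrow> (real^'n) \<times> (real^'n)"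
  where "displacement k e a b =
    ((\<chi> i. sqrt (k / 2) * arccos ((fst a *v e i) \<bullet> (fst b *v e i))),
     (\<chi> j. ln (snd b $ j $ j) - ln (snd a $ j $ j)))"

lemma norm_vec_square: "(norm (v :: real^'n::finite))\<^sup>2 = (\<Sum>i\<in>UNIV. (v $ i)\<^sup>2)"
  by (simp only: power2_norm_eq_inner inner_vec_def) (simp add: power2_eq_square)

lemma norm_pair_square: "(norm (x, y))\<^sup>2 = (norm x)\<^sup>2 + (norm y)\<^sup>2"
  by (simp add: norm_Pair)

lemma norm_displacement_square:
  assumes "k \<ge> 0"
  shows "(norm (displacement k e a b))\<^sup>2 =
    k / 2 * (\<Sum>i\<in>UNIV. (arccos ((fst a *v e i) \<bullet> (fst b *v e i)))\<^sup>2) +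
    (\<Sum>j\<in>UNIV. (ln (snd b $ j $ j) - ln (snd a $ j $ j))\<^sup>2)"
  using assms
  by (simp add: displacement_def norm_pair_square norm_vec_square power_mult_distrib sum_distrib_left)

text \<open>The angle between a fixed unit vector \<open>x0\<close> and a moving one \<open>x\<close> grows at most with the speed of
  \<open>x\<close>, but \<open>arccos (x0 \<bullet> x)\<close> is not differentiable where \<open>x = x0\<close> or \<open>x = - x0\<close>.  The damped function
  \<open>arccos (q * (x0 \<bullet> x))\<close> with \<open>q < 1\<close> is differentiable everywhere and obeys the same bound.\<close>

lemma damped_angle_derivative_bound:
  fixes x0 x x' :: "'a::real_inner"
  assumes n: "norm x0 = 1" "norm x = 1" and tangent: "x' \<bullet> x = 0" and q: "0 < q" "q < 1"
  shows "\<bar>q * (x0 \<bullet> x')\<bar> / sqrt (1 - (q * (x0 \<bullet> x))\<^sup>2) \<le> norm x'"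
proof -
  define u where "u = x0 \<bullet> x"
  have u: "\<bar>u\<bar> \<le> 1" unfolding u_def using n by (rule unit_inner_bound)
  have u2: "u\<^sup>2 \<le> 1" using u by (simp add: abs_square_le_1)
  have q2: "q\<^sup>2 < 1" using q by (simp add: power_less_one_iff)
  have xx: "x0 \<bullet> x0 = 1" "x \<bullet> x = 1" using n by (metis norm_eq_1)+
  have nw: "norm (x0 - u *\<^sub>R x) = sqrt (1 - u\<^sup>2)"
    by (simp add: norm_eq_sqrt_inner inner_diff xx inner_commute[of x x0] power2_eq_square flip: u_def)
  have "x0 \<bullet> x' = (x0 - u *\<^sub>R x) \<bullet> x'"
    using tangent by (simp add: inner_diff_left inner_commute[of x x'])
  then have "\<bar>x0 \<bullet> x'\<bar> \<le> sqrt (1 - u\<^sup>2) * norm x'"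
    using Cauchy_Schwarz_ineq2[of "x0 - u *\<^sub>R x" x'] nw by simp
  then have "\<bar>q * (x0 \<bullet> x')\<bar> \<le> q * (sqrt (1 - u\<^sup>2) * norm x')"
    using q by (simp add: abs_mult mult_left_mono)
  also have "\<dots> = sqrt (q\<^sup>2 * (1 - u\<^sup>2)) * norm x'"
    using q by (simp add: real_sqrt_mult)
  also have "\<dots> \<le> sqrt (1 - (q * u)\<^sup>2) * norm x'"
    using q2 by (intro mult_right_mono) (simp_all add: power_mult_distrib algebra_simps)
  finally have *: "\<bar>q * (x0 \<bullet> x')\<bar> \<le> norm x' * sqrt (1 - (q * u)\<^sup>2)" by (simp add: mult.commute)
  have "q\<^sup>2 * u\<^sup>2 \<le> q\<^sup>2 * 1" using u2 by (intro mult_left_mono) auto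
  then have "(q * u)\<^sup>2 < 1" using q2 by (simp add: power_mult_distrib)
  then have "0 < sqrt (1 - (q * u)\<^sup>2)" by simp
  then show "\<bar>q * (x0 \<bullet> x')\<bar> / sqrt (1 - (q * (x0 \<bullet> x))\<^sup>2) \<le> norm x'"
    using * by (simp add: pos_divide_le_eq flip: u_def)
qed

lemma norm_le_of_square_le:
  fixes z :: "'a::real_normed_vector"
  assumes "(norm z)\<^sup>2 \<le> norm z * L" "0 \<le> L"
  shows "norm z \<le> L"
proof (cases "norm z = 0")
  case False
  then have "norm z > 0" by simp
  then show ?thesis using assms(1) by (simp add: power2_eq_square)
qed (use assms in simp)

text \<open>A calibration argument.  The function \<open>\<Phi>\<close> is the projection of the displacement from the start
  of the curve onto the final displacement \<open>z\<close>, with all angles damped by a factor \<open>q < 1\<close>.  By Cauchy--Schwarz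
  its derivative is at most \<open>norm z\<close> times the speed.  Integrating and letting \<open>q\<close> tend to \<open>1\<close>
  gives \<open>(norm z)\<^sup>2 \<le> norm z * length\<close>.\<close>

lemma displacement_le_length:
  fixes c :: "real \<Rightarrow> 'n::finite sqmat \<times> 'n sqmat"
  assumes k: "k \<ge> 0" and c: "curve_in_M c" and rs: "0 \<le> r" "r \<le> s" "s \<le> 1"
    and e: "orthonormal_frame e"
  shows "norm (displacement k e (c r) (c s)) \<le>
    integral {r..s} (\<lambda>t. tangent_norm k (c t) (vector_derivative c (at t)))"
proof -
  let ?\<sigma> = "\<lambda>t. tangent_norm k (c t) (vector_derivative c (at t))"
  obtain K where K: "finite K" and cont: "continuous_on {0..1} c"
    and der: "\<And>t. t \<in> {0<..<1} - K \<Longrightarrow> (c has_vector_derivative vector_derivative c (at t)) (at t)"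
    and int01: "?\<sigma> integrable_on {0..1}"
    using curve_regular[OF c, of k] by blast
  have M: "\<And>t. t \<in> {0..1} \<Longrightarrow> c t \<in> M" using c by (simp add: curve_in_M_def)
  have int: "?\<sigma> integrable_on {r..s}"
    using integrable_subinterval_real[OF int01] rs by auto
  define z where "z = displacement k e (c r) (c s)"
  define \<theta> where "\<theta> i = arccos ((fst (c r) *v e i) \<bullet> (fst (c s) *v e i))" for i
  define \<delta> where "\<delta> j = ln (snd (c s) $ j $ j) - ln (snd (c r) $ j $ j)" for j
  define u where "u i t = (fst (c r) *v e i) \<bullet> (fst (c t) *v e i)" for i t
  define \<Phi> where "\<Phi> q t = (\<Sum>i\<in>UNIV. k / 2 * \<theta> i * arccos (q * u i t)) +
      (\<Sum>j\<in>UNIV. \<delta> j * ln (snd (c t) $ j $ j))" for q t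
  have z: "z = ((\<chi> i. sqrt (k / 2) * \<theta> i), (\<chi> j. \<delta> j))"
    by (simp add: z_def displacement_def \<theta>_def \<delta>_def)
  have nrm: "norm (fst (c t) *v e i) = 1" if "t \<in> {0..1}" for t i
    using in_M_D[OF M[OF that]] by (simp add: orthogonal_norm frame_norm_one[OF e])
  have r01: "r \<in> {0..1}" and s01: "s \<in> {0..1}" using rs by auto
  have \<theta>_nonneg: "\<theta> i \<ge> 0" for i
    unfolding \<theta>_def using unit_inner_bound[OF nrm[OF r01] nrm[OF s01], of i i] by (intro arccos_lbound) auto
  have pos: "snd (c t) $ j $ j > 0" if "t \<in> {0..1}" for t j
    using in_M_D[OF M[OF that]] by (simp add: Diag_pos_def)
  have u1: "\<bar>u i t\<bar> \<le> 1" if "t \<in> {0..1}" for i t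
    unfolding u_def using unit_inner_bound[OF nrm[OF r01] nrm[OF that], of i i] .
  have contu: "continuous_on {r..s} (u i)" for i
    unfolding u_def
    by (intro continuous_intros bounded_linear.continuous_on[OF bounded_linear_mult_vec]
         continuous_on_subset[OF cont]) (use rs in auto)
  have step: "\<Phi> q s - \<Phi> q r \<le> norm z * integral {r..s} ?\<sigma>" if q: "0 < q" "q < 1" for q
  proof -
    define \<phi> where "\<phi> t = (\<Sum>i\<in>UNIV. k / 2 * \<theta> i *
          (- (q * ((fst (c r) *v e i) \<bullet> (fst (vector_derivative c (at t)) *v e i))) / sqrt (1 - (q * u i t)\<^sup>2))) +
        (\<Sum>j\<in>UNIV. \<delta> j * (snd (vector_derivative c (at t)) $ j $ j / snd (c t) $ j $ j))" for t
    have qu: "\<bar>q * u i t\<bar> \<le> q" if "t \<in> {0..1}" for i t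
      using u1[OF that, of i] q mult_left_le[of "\<bar>u i t\<bar>" q] by (simp add: abs_mult)
    have "continuous_on {r..s} (\<Phi> q)"
      unfolding \<Phi>_def
    proof (intro continuous_intros contu)
      show "\<forall>t\<in>{r..s}. - 1 \<le> q * u i t \<and> q * u i t \<le> 1" for i
      proof
        fix t assume "t \<in> {r..s}"
        then have "\<bar>q * u i t\<bar> \<le> q" using rs by (intro qu) auto
        then show "- 1 \<le> q * u i t \<and> q * u i t \<le> 1" using q by linarith
      qed
      show "\<forall>t\<in>{r..s}. snd (c t) $ j $ j \<noteq> 0" for j
      proof
        fix t assume "t \<in> {r..s}"
        then show "snd (c t) $ j $ j \<noteq> 0" using rs pos[of t j] by auto
      qed
      show "continuous_on {r..s} c" using rs by (intro continuous_on_subset[OF cont]) auto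
    qed
    moreover have "(\<Phi> q has_vector_derivative \<phi> t) (at t)" if "t \<in> {r<..<s} - K" for t
    proof -
      have t: "t \<in> {0<..<1}" "t \<in> {0<..<1} - K" "t \<in> {0..1}" using that rs by auto
      let ?v = "vector_derivative c (at t)"
      note d = der[OF t(2)]
      have dU: "((\<lambda>s. fst (c s) *v x) has_vector_derivative fst ?v *v x) (at t)" for x
        using bounded_linear.has_vector_derivative[OF bounded_linear_compose[OF bounded_linear_mult_vec bounded_linear_fst] d] by simp
      have dD: "((\<lambda>s. snd (c s) $ i $ j) has_real_derivative snd ?v $ i $ j) (at t)" for i j
        using bounded_linear.has_vector_derivative[OF bounded_linear_compose[OF bounded_linear_entry bounded_linear_snd] d]
        by (simp add: has_real_derivative_iff_has_vector_derivative)
      have du: "(u i has_real_derivative (fst (c r) *v e i) \<bullet> (fst ?v *v e i)) (at t)" for i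
        unfolding u_def has_real_derivative_iff_has_vector_derivative
        by (rule bounded_linear.has_vector_derivative[OF bounded_linear_inner_right dU])
      have lt: "- 1 < q * u i t" "q * u i t < 1" for i
        using qu[OF t(3), of i] q by linarith+
      have darc: "((\<lambda>s. arccos (q * u i s)) has_real_derivative
          - (q * ((fst (c r) *v e i) \<bullet> (fst ?v *v e i))) / sqrt (1 - (q * u i t)\<^sup>2)) (at t)" for i
        by (rule DERIV_cong[OF DERIV_chain2[OF DERIV_arccos[OF lt] DERIV_cmult[OF du]]])
           (simp add: divide_inverse mult.commute)
      have dln: "((\<lambda>s. ln (snd (c s) $ j $ j)) has_real_derivative
          snd ?v $ j $ j / snd (c t) $ j $ j) (at t)" for j
        by (rule DERIV_cong[OF DERIV_chain2[OF DERIV_ln[OF pos[OF t(3)]] dD]])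
           (simp add: divide_inverse mult.commute)
      have "(\<Phi> q has_real_derivative \<phi> t) (at t)"
        unfolding \<Phi>_def \<phi>_def
        by (intro DERIV_add DERIV_sum DERIV_cmult darc dln)
      then show ?thesis by (simp add: has_real_derivative_iff_has_vector_derivative)
    qed
    ultimately have FTC: "(\<phi> has_integral (\<Phi> q s - \<Phi> q r)) {r..s}"
      by (intro fundamental_theorem_of_calculus_interior_strong[OF K rs(2)])
    have bound: "\<phi> t \<le> norm z * ?\<sigma> t" if "t \<in> {r..s} - insert r (insert s K)" for t
    proof -
      have t: "t \<in> {0<..<1}" "t \<in> {0<..<1} - K" "t \<in> {0..1}" using that rs by auto
      let ?v = "vector_derivative c (at t)"
      define w where "w = ((\<chi> i. sqrt (k / 2) * norm (fst ?v *v e i)), (\<chi> j. snd ?v $ j $ j / snd (c t) $ j $ j))"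
      have "- (q * ((fst (c r) *v e i) \<bullet> (fst ?v *v e i))) / sqrt (1 - (q * u i t)\<^sup>2) \<le> norm (fst ?v *v e i)" for i
      proof -
        have "- (q * ((fst (c r) *v e i) \<bullet> (fst ?v *v e i))) / sqrt (1 - (q * u i t)\<^sup>2)
          \<le> \<bar>q * ((fst (c r) *v e i) \<bullet> (fst ?v *v e i))\<bar> / sqrt (1 - (q * u i t)\<^sup>2)"
          using qu[OF t(3), of i] q abs_square_le_1[of "q * u i t"]
          by (intro divide_right_mono) auto
        also have "\<dots> \<le> norm (fst ?v *v e i)"
          unfolding u_def
          by (rule damped_angle_derivative_bound[OF nrm[OF r01] nrm[OF t(3)] velocity_tangent(3)[OF M t(1) der[OF t(2)]] q])
        finally show ?thesis .
      qed
      then have "\<phi> t \<le> (\<Sum>i\<in>UNIV. k / 2 * \<theta> i * norm (fst ?v *v e i)) +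
          (\<Sum>j\<in>UNIV. \<delta> j * (snd ?v $ j $ j / snd (c t) $ j $ j))"
        unfolding \<phi>_def using \<theta>_nonneg k by (intro add_mono sum_mono mult_left_mono order.refl) auto
      also have "\<dots> = z \<bullet> w"
      proof -
        have "sqrt (k / 2) * x * (sqrt (k / 2) * y) = (sqrt (k / 2) * sqrt (k / 2)) * x * y" for x y
          by (simp only: mult_ac)
        then have "sqrt (k / 2) * x * (sqrt (k / 2) * y) = k / 2 * x * y" for x y
          using k by simp
        then show ?thesis
          unfolding z w_def inner_Pair inner_vec_def vec_lambda_beta inner_real_def by presburger
      qed
      also have "\<dots> \<le> norm z * norm w" by (rule norm_cauchy_schwarz)
      also have "norm w = ?\<sigma> t"
      proof -
        have "(norm w)\<^sup>2 = (\<Sum>i\<in>UNIV. k / 2 * (norm (fst ?v *v e i))\<^sup>2) +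
            (\<Sum>j\<in>UNIV. (snd ?v $ j $ j / snd (c t) $ j $ j)\<^sup>2)"
          using k by (simp add: w_def norm_pair_square norm_vec_square power_mult_distrib)
        then have "(norm w)\<^sup>2 = (?\<sigma> t)\<^sup>2"
          unfolding sum_distrib_left[symmetric] frame_norm_matrix[OF e]
          using k by (simp add: tangent_norm_def sum_nonneg)
        then show ?thesis
          by (rule power2_eq_imp_eq[OF _ norm_ge_zero tangent_norm_nonneg[OF k]])
      qed
      finally show ?thesis .
    qed
    have neg: "negligible (insert r (insert s K))" using K by (intro negligible_finite) simp
    \<comment> \<open>At the exceptional parameters \<open>\<phi>\<close> need not obey the bound; there it is replaced by it.\<close>
    define \<psi> where "\<psi> t = (if t \<in> insert r (insert s K) then norm z * ?\<sigma> t else \<phi> t)" for t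
    have "(\<psi> has_integral (\<Phi> q s - \<Phi> q r)) {r..s}"
      by (rule has_integral_spike[OF neg _ FTC]) (simp add: \<psi>_def)
    moreover have "((\<lambda>t. norm z * ?\<sigma> t) has_integral norm z * integral {r..s} ?\<sigma>) {r..s}"
      using int by (intro has_integral_mult_right integrable_integral)
    moreover have "\<psi> t \<le> norm z * ?\<sigma> t" if "t \<in> {r..s}" for t
      using bound[of t] that by (auto simp: \<psi>_def)
    ultimately show ?thesis by (rule has_integral_le)
  qed
  have \<Phi>1: "\<Phi> 1 s - \<Phi> 1 r = (norm z)\<^sup>2"
  proof -
    have ln_part: "(\<Sum>j\<in>UNIV. \<delta> j * ln (snd (c s) $ j $ j)) - (\<Sum>j\<in>UNIV. \<delta> j * ln (snd (c r) $ j $ j))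
        = (\<Sum>j\<in>UNIV. \<delta> j * \<delta> j)"
      unfolding sum_subtractf[symmetric] by (rule sum.cong) (simp_all add: \<delta>_def algebra_simps)
    have "u i s = (fst (c r) *v e i) \<bullet> (fst (c s) *v e i)" "u i r = 1" for i
      using nrm[OF r01, of i] by (simp_all add: u_def flip: power2_norm_eq_inner)
    then have "\<Phi> 1 s - \<Phi> 1 r = (\<Sum>i\<in>UNIV. k / 2 * \<theta> i * \<theta> i) + (\<Sum>j\<in>UNIV. \<delta> j * \<delta> j)"
      unfolding \<Phi>_def using ln_part by (simp add: \<theta>_def[symmetric])
    then show ?thesis
      unfolding z_def norm_displacement_square[OF k] \<theta>_def[symmetric] \<delta>_def[symmetric]
      by (simp add: power2_eq_square sum_distrib_left mult.assoc)
  qed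
  have lim: "((\<lambda>q. \<Phi> q s - \<Phi> q r) \<longlongrightarrow> \<Phi> 1 s - \<Phi> 1 r) (at_left 1)"
  proof -
    have *: "((\<lambda>q. arccos (q * u i t)) \<longlongrightarrow> arccos (1 * u i t)) (at_left 1)" if "t \<in> {0..1}" for i t
    proof -
      have "continuous_on {0..1} (\<lambda>q. arccos (q * u i t))"
      proof (intro continuous_intros, rule ballI)
        fix q :: real assume "q \<in> {0..1}"
        then have "\<bar>q * u i t\<bar> \<le> 1" using u1[OF that, of i] by (simp add: abs_mult mult_le_one)
        then show "- 1 \<le> q * u i t \<and> q * u i t \<le> 1" by linarith
      qed
      then have "((\<lambda>q. arccos (q * u i t)) \<longlongrightarrow> arccos (1 * u i t)) (at 1 within {0..1})"
        unfolding continuous_on_def by (rule bspec) simp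
      then show ?thesis by (simp add: at_within_Icc_at_left)
    qed
    show ?thesis unfolding \<Phi>_def by (intro tendsto_intros * s01 r01)
  qed
  have "\<Phi> 1 s - \<Phi> 1 r \<le> norm z * integral {r..s} ?\<sigma>"
  proof (rule tendsto_upperbound[OF lim])
    have "eventually (\<lambda>q. q \<in> {0<..<1}) (at_left (1::real))"
      by (rule eventually_at_leftI[of 0]) auto
    then show "\<forall>\<^sub>F q in at_left 1. \<Phi> q s - \<Phi> q r \<le> norm z * integral {r..s} ?\<sigma>"
      by (rule eventually_mono) (simp add: step)
  qed simp
  then have "(norm z)\<^sup>2 \<le> norm z * integral {r..s} ?\<sigma>" by (simp add: \<Phi>1)
  moreover have "0 \<le> integral {r..s} ?\<sigma>"
    by (rule integral_nonneg[OF int]) (simp add: tangent_norm_nonneg[OF k])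
  ultimately show ?thesis unfolding z_def[symmetric] by (rule norm_le_of_square_le)
qed

section \<open>Explicit shortest curves\<close>

text \<open>The rank-one matrix \<open>x y\<^sup>T\<close>.\<close>

definition outer :: "real^'n \<Rightarrow> real^'n \<Rightarrow> 'n::finite sqmat"
  where "outer x y = (\<chi> a b. x $ a * y $ b)"

lemma outer_mult_vec: "outer x y *v z = (y \<bullet> z) *\<^sub>R x"
  by (simp add: outer_def matrix_vector_mult_def inner_vec_def vec_eq_iff sum_distrib_left mult_ac)

lemma sum_mult_vec: "(\<Sum>i\<in>A. G i) *v x = (\<Sum>i\<in>A. G i *v (x :: real^'n::finite))"
  by (induction A rule: infinite_finite_induct) (simp_all add: matrix_vector_mult_add_rdistrib)

lemma orthogonal_matrix_of_frame:
  fixes A :: "'n::finite sqmat"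
  assumes e: "orthonormal_frame e" and A: "\<And>i j. (A *v e i) \<bullet> (A *v e j) = e i \<bullet> e j"
  shows "orthogonal_matrix A"
  unfolding orthogonal_matrix
proof (rule frame_matrix_eqI[OF e])
  fix i
  let ?d = "(transpose A ** A) *v e i - e i"
  have "?d \<bullet> e j = 0" for j
    using A[of i j] transpose_move[of "A *v e i" A "e j"]
    by (simp add: inner_diff_left flip: matrix_vector_mul_assoc del: transpose_matrix_vector)
  then have "?d = 0" using frame_expansion[OF e, of ?d] by simp
  then show "(transpose A ** A) *v e i = mat 1 *v e i" by simp
qed

lemma continuous_on_det:
  fixes W :: "real \<Rightarrow> 'n::finite sqmat"
  assumes "continuous_on S W"
  shows "continuous_on S (\<lambda>t. det (W t))"
  unfolding det_def by (intro continuous_intros assms)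

lemma det_orthogonal_path:
  fixes W :: "real \<Rightarrow> 'n::finite sqmat"
  assumes cont: "continuous_on UNIV W" and orth: "\<And>t. orthogonal_matrix (W t)" and 0: "det (W 0) = 1"
  shows "det (W t) = 1"
proof (rule ccontr)
  assume neg: "det (W t) \<noteq> 1"
  have pm: "det (W s) = 1 \<or> det (W s) = - 1" for s using det_orthogonal_matrix[OF orth] .
  have "connected (range (\<lambda>s. det (W s)))"
    by (intro connected_continuous_image continuous_on_det cont) simp
  moreover have "- 1 \<in> range (\<lambda>s. det (W s))" using neg pm[of t] by (metis rangeI)
  moreover have "1 \<in> range (\<lambda>s. det (W s))" using 0 by (metis rangeI)
  ultimately have "0 \<in> range (\<lambda>s. det (W s))"
    by (rule connectedD_interval) auto
  then obtain s where "det (W s) = 0" by (metis rangeE)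
  then show False using pm[of s] by simp
qed

text \<open>\<open>Q\<close> commutes with its symmetric part, so it maps each eigenspace of the symmetric part
  to itself, and there it differs from a multiple of the identity by a skew map.\<close>

lemma adapted_frame_orthogonality:
  fixes Q :: "'n::finite sqmat"
  assumes Q: "orthogonal_matrix Q" and e: "adapted_frame Q e" and ij: "i \<noteq> j"
  shows "(Q *v e i) \<bullet> e j = - (e i \<bullet> (Q *v e j))"
    and "e i \<bullet> (Q *v e j) = 0 \<or> e i \<bullet> (Q *v e i) = e j \<bullet> (Q *v e j)"
proof -
  have fr: "orthonormal_frame e" using e by (simp add: adapted_frame_def)
  define x where "x i = e i \<bullet> (Q *v e i)" for i
  have H: "Q *v e i + transpose Q *v e i = (2 * x i) *\<^sub>R e i" for i
    using e by (simp add: adapted_frame_def x_def)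
  have "e i \<bullet> (Q *v e j) + e i \<bullet> (transpose Q *v e j) = 0"
    unfolding inner_add_right[symmetric] H using ij by (simp add: frame_inner[OF fr])
  moreover have "e i \<bullet> (transpose Q *v e j) = (Q *v e i) \<bullet> e j"
    by (metis transpose_move transpose_transpose)
  ultimately show "(Q *v e i) \<bullet> e j = - (e i \<bullet> (Q *v e j))" by linarith
  have QT: "transpose Q *v (Q *v y) = y" "Q *v (transpose Q *v y) = y" for y
    using Q by (simp_all add: orthogonal_matrix_def matrix_vector_mul_assoc del: transpose_matrix_vector)
  have "(2 * x i) * (e i \<bullet> (Q *v e j)) = (Q *v e i + transpose Q *v e i) \<bullet> (Q *v e j)"
    unfolding H by simp
  also have "\<dots> = e i \<bullet> e j + e i \<bullet> (Q *v (Q *v e j))"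
    using transpose_move[of "e i" Q "Q *v e j"]
    by (simp add: inner_add_left orthogonal_inner[OF Q] del: transpose_matrix_vector)
  also have "\<dots> = e i \<bullet> (Q *v (Q *v e j + transpose Q *v e j))"
    by (simp add: matrix_vector_right_distrib inner_add_right QT del: transpose_matrix_vector)
  also have "\<dots> = (2 * x j) * (e i \<bullet> (Q *v e j))"
    unfolding H by (simp add: matrix_vector_mult_scaleR)
  finally have "(x i - x j) * (e i \<bullet> (Q *v e j)) = 0" by (simp add: algebra_simps)
  then show "e i \<bullet> (Q *v e j) = 0 \<or> e i \<bullet> (Q *v e i) = e j \<bullet> (Q *v e j)"
    by (auto simp: x_def)
qed

lemma displacement_le_curve_length:
  assumes "k \<ge> 0" "curve_in_M c" "orthonormal_frame e"
  shows "norm (displacement k e (c 0) (c 1)) \<le> curve_length k c"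
  unfolding curve_length_eq[OF assms(2)]
  by (rule displacement_le_length[OF assms(1,2) _ _ _ assms(3)]) simp_all

lemma curve_length_nonneg:
  assumes "k \<ge> 0" "curve_in_M c"
  shows "curve_length k c \<ge> 0"
  by (rule order_trans[OF norm_ge_zero displacement_le_curve_length[OF assms frame_axis]])

lemma dist_M_le_length:
  assumes "k \<ge> 0" "curve_in_M c" "c 0 = a" "c 1 = b"
  shows "dist_M k a b \<le> curve_length k c"
  unfolding dist_M_def
proof (rule cInf_lower)
  show "curve_length k c \<in> {curve_length k c |c. curve_in_M c \<and> c 0 = a \<and> c 1 = b}"
    using assms(2-4) by blast
  show "bdd_below {curve_length k c |c. curve_in_M c \<and> c 0 = a \<and> c 1 = b}"
    using curve_length_nonneg[OF assms(1)] by (intro bdd_belowI[of _ 0]) blast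
qed

text \<open>The curve \<open>W\<close> moves every \<open>U e i\<close> to \<open>V e i\<close> at constant speed along a great circle, in the
  direction \<open>q i\<close>.  These motions fit together to an orthogonal matrix: axes with different angles span
  orthogonal planes, and for axes with the same angle the two mixed terms cancel by skew-symmetry.
  The hypothesis on the eigenvalue \<open>-1\<close> is what makes all these great circles well defined.  The diagonal part is
  interpolated linearly in logarithmic coordinates.\<close>

lemma shortest_curve_exists:
  fixes U V D L :: "'n::finite sqmat"
  assumes k: "k \<ge> 0" and a: "(U, D) \<in> M" and b: "(V, L) \<in> M"
    and noeig: "\<And>v. v \<noteq> 0 \<Longrightarrow> (transpose U ** V) *v v \<noteq> - v"
    and e: "adapted_frame (transpose U ** V) e"
  obtains c where "curve_in_M c" "c 0 = (U, D)" "c 1 = (V, L)"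
    "curve_length k c = norm (displacement k e (U, D) (V, L))"
proof -
  define Q where "Q = transpose U ** V"
  have U: "orthogonal_matrix U" and detU: "det U = 1" and D: "D \<in> Diag_pos"
    using in_M_D[OF a] by simp_all
  have V: "orthogonal_matrix V" and L: "L \<in> Diag_pos"
    using in_M_D[OF b] by simp_all
  have Q: "orthogonal_matrix Q" unfolding Q_def using U V by (simp add: orthogonal_matrix_mul)
  have eQ: "adapted_frame Q e" using e by (simp add: Q_def)
  have fr: "orthonormal_frame e" using e by (simp add: adapted_frame_def)
  have UQ: "U *v (Q *v y) = V *v y" for y
  proof -
    have "U ** Q = V" using U by (simp add: Q_def matrix_mul_assoc orthogonal_matrix_def)
    then show ?thesis by (simp add: matrix_vector_mul_assoc)
  qed
  define x where "x i = e i \<bullet> (Q *v e i)" for i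
  define \<theta> where "\<theta> i = arccos (x i)" for i
  define p where "p i = U *v e i" for i
  define y where "y i = V *v e i" for i
  \<comment> \<open>The unit tangent at \<open>p i\<close> of the great circle towards \<open>y i\<close>; if \<open>\<theta> i = 0\<close>, division by
    zero makes it the zero vector, and \<open>p i\<close> stays at rest.\<close>
  define q where "q i = (1 / sin (\<theta> i)) *\<^sub>R (y i - x i *\<^sub>R p i)" for i
  have x1: "\<bar>x i\<bar> \<le> 1" for i unfolding x_def using cos_bound[OF Q frame_norm_one[OF fr]] .
  have xm1: "x i \<noteq> - 1" for i
  proof
    assume "x i = - 1"
    then have "e i \<bullet> (Q *v e i) = - 1" by (simp only: x_def)
    moreover have "norm (e i) = 1" "norm (Q *v e i) = 1"
      by (simp_all add: frame_norm_one[OF fr] orthogonal_norm[OF Q])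
    ultimately have "Q *v e i = - e i" using unit_inner_minus_one_imp_eq by blast
    moreover have "e i \<noteq> 0" using frame_norm_one[OF fr, of i] by auto
    ultimately show False using noeig by (simp add: Q_def)
  qed
  have cos\<theta>: "cos (\<theta> i) = x i" for i unfolding \<theta>_def using x1 by (simp add: cos_arccos_abs)
  have \<theta>: "0 \<le> \<theta> i" "\<theta> i < pi" for i
  proof -
    show "0 \<le> \<theta> i" unfolding \<theta>_def using x1[of i] by (intro arccos_lbound) auto
    have "\<theta> i \<le> pi" unfolding \<theta>_def using x1[of i] by (intro arccos_ubound) auto
    moreover have "\<theta> i \<noteq> pi" using cos\<theta>[of i] xm1[of i] by auto
    ultimately show "\<theta> i < pi" by simp
  qed
  have sin\<theta>: "sin (\<theta> i) \<noteq> 0 \<or> \<theta> i = 0" for i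
    using \<theta>[of i] sin_gt_zero[of "\<theta> i"] by force
  have pp: "p i \<bullet> p j = (if i = j then 1 else 0)" for i j
    by (simp add: p_def orthogonal_inner[OF U] frame_inner[OF fr])
  have yy: "y i \<bullet> y j = (if i = j then 1 else 0)" for i j
    by (simp add: y_def orthogonal_inner[OF V] frame_inner[OF fr])
  have py: "p i \<bullet> y j = e i \<bullet> (Q *v e j)" "y i \<bullet> p j = (Q *v e i) \<bullet> e j" for i j
    by (simp_all add: p_def y_def orthogonal_inner[OF U] flip: UQ)
  have yp: "y i \<bullet> p i = x i" for i by (simp add: py x_def inner_commute)
  have \<theta>0: "y i = p i" if "\<theta> i = 0" for i
  proof (rule unit_inner_one_imp_eq)
    show "norm (y i) = 1" "norm (p i) = 1" using yy[of i i] pp[of i i] by (simp_all add: norm_eq_sqrt_inner)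
    show "y i \<bullet> p i = 1" using cos\<theta>[of i] yp[of i] that by simp
  qed
  have pq: "p i \<bullet> q i = 0" for i
    using pp[of i i] py(1)[of i i] by (simp add: q_def inner_diff_right x_def)
  have qq: "q i \<bullet> q i = (if \<theta> i = 0 then 0 else 1)" for i
  proof (cases "\<theta> i = 0")
    case False
    then have s: "sin (\<theta> i) \<noteq> 0" using sin\<theta> by blast
    have "(y i - x i *\<^sub>R p i) \<bullet> (y i - x i *\<^sub>R p i) = 1 - (x i)\<^sup>2"
      using pp[of i i] yy[of i i] yp[of i]
      by (simp add: inner_diff inner_commute[of "p i" "y i"] power2_eq_square)
    also have "\<dots> = (sin (\<theta> i))\<^sup>2" by (simp add: sin_squared_eq cos\<theta>)
    finally show ?thesis using s False by (simp add: q_def power2_eq_square)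
  qed (simp add: q_def)
  define W where "W t = (\<Sum>i\<in>UNIV. cos (t * \<theta> i) *\<^sub>R outer (p i) (e i) + sin (t * \<theta> i) *\<^sub>R outer (q i) (e i))" for t
  define W' where "W' t = (\<Sum>i\<in>UNIV. (- (sin (t * \<theta> i) * \<theta> i)) *\<^sub>R outer (p i) (e i) + (cos (t * \<theta> i) * \<theta> i) *\<^sub>R outer (q i) (e i))" for t
  have frame_sum: "(\<Sum>i\<in>UNIV. \<alpha> i *\<^sub>R outer (p i) (e i) + \<beta> i *\<^sub>R outer (q i) (e i)) *v e j = \<alpha> j *\<^sub>R p j + \<beta> j *\<^sub>R q j"
    for \<alpha> \<beta> and j
  proof -
    have "(\<Sum>i\<in>UNIV. \<alpha> i *\<^sub>R outer (p i) (e i) + \<beta> i *\<^sub>R outer (q i) (e i)) *v e j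
       = (\<Sum>i\<in>UNIV. if i = j then \<alpha> j *\<^sub>R p j + \<beta> j *\<^sub>R q j else 0)"
      unfolding sum_mult_vec
      by (intro sum.cong refl)
         (auto simp: matrix_vector_mult_add_rdistrib outer_mult_vec frame_inner[OF fr] simp flip: scaleR_matrix_vector_assoc)
    then show ?thesis by simp
  qed
  have We: "W t *v e j = cos (t * \<theta> j) *\<^sub>R p j + sin (t * \<theta> j) *\<^sub>R q j" for t j
    unfolding W_def by (rule frame_sum)
  have W'e: "W' t *v e j = (- (sin (t * \<theta> j) * \<theta> j)) *\<^sub>R p j + (cos (t * \<theta> j) * \<theta> j) *\<^sub>R q j" for t j
    unfolding W'_def by (rule frame_sum)
  have W_orth: "orthogonal_matrix (W t)" for t
  proof (rule orthogonal_matrix_of_frame[OF fr])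
    fix i j
    show "(W t *v e i) \<bullet> (W t *v e j) = e i \<bullet> e j"
    proof (cases "i = j")
      case True
      then show ?thesis
        using pp[of j j] pq[of j] qq[of j] sin_cos_squared_add[of "t * \<theta> j"]
        by (simp add: We inner_add inner_commute[of "q j" "p j"] frame_inner[OF fr] power2_eq_square)
    next
      case False
      define m where "m = p i \<bullet> y j"
      have m: "y i \<bullet> p j = - m" "m = 0 \<or> x i = x j"
        using adapted_frame_orthogonality[OF Q eQ False] by (simp_all add: m_def py x_def)
      have 1: "p i \<bullet> q j = m / sin (\<theta> j)"
        using pp[of i j] False by (simp add: q_def inner_diff_right m_def)
      have 2: "q i \<bullet> p j = - m / sin (\<theta> i)"
        using pp[of i j] False by (simp add: q_def inner_diff_left m)
      have "(y i - x i *\<^sub>R p i) \<bullet> (y j - x j *\<^sub>R p j) = (x j - x i) * m"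
        using pp[of i j] yy[of i j] False m(1)
        by (simp add: inner_diff m_def[symmetric] algebra_simps)
      then have 3: "q i \<bullet> q j = 0" using m(2) by (auto simp: q_def)
      have "m = 0 \<or> \<theta> i = \<theta> j" using m(2) by (auto simp: \<theta>_def)
      then show ?thesis
        using False pp[of i j]
        by (auto simp: We inner_add 1 2 3 frame_inner[OF fr])
    qed
  qed
  have W0: "W 0 = U" by (rule frame_matrix_eqI[OF fr]) (simp add: We p_def)
  have W1: "W 1 = V"
  proof (rule frame_matrix_eqI[OF fr])
    fix i
    show "W 1 *v e i = V *v e i"
    proof (cases "\<theta> i = 0")
      case True
      then show ?thesis using \<theta>0[of i] by (simp add: We y_def)
    next
      case False
      then show ?thesis using sin\<theta>[of i] by (simp add: We q_def cos\<theta> y_def)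
    qed
  qed
  have dW: "(W has_vector_derivative W' t) (at t)" for t
    unfolding W_def W'_def
    by (auto intro!: derivative_eq_intros simp: has_real_derivative_iff_has_vector_derivative[symmetric])
  have contW: "continuous_on UNIV W"
    unfolding W_def by (intro continuous_intros)
  have detW: "det (W t) = 1" for t
    by (rule det_orthogonal_path[OF contW W_orth]) (simp add: W0 detU)
  define \<delta> where "\<delta> j = ln (L $ j $ j) - ln (D $ j $ j)" for j
  define E where "E t = (\<Sum>j\<in>UNIV. exp (ln (D $ j $ j) + t * \<delta> j) *\<^sub>R outer (axis j 1) (axis j 1 :: real^'n))" for t
  define E' where "E' t = (\<Sum>j\<in>UNIV. (exp (ln (D $ j $ j) + t * \<delta> j) * \<delta> j) *\<^sub>R outer (axis j 1) (axis j 1 :: real^'n))" for t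
  have diag_sum: "(\<Sum>j\<in>UNIV. \<alpha> j *\<^sub>R outer (axis j 1) (axis j 1 :: real^'n)) $ a $ b = (if a = b then \<alpha> a else 0)"
    for \<alpha> a b
    by (simp add: outer_def axis_def if_distrib[of "\<lambda>x. _ * x"] cong: if_cong)
  have E: "E t $ i $ j = (if i = j then exp (ln (D $ i $ i) + t * \<delta> i) else 0)" for t i j
    unfolding E_def by (rule diag_sum)
  have E': "E' t $ i $ j = (if i = j then exp (ln (D $ i $ i) + t * \<delta> i) * \<delta> i else 0)" for t i j
    unfolding E'_def by (rule diag_sum)
  have dE: "(E has_vector_derivative E' t) (at t)" for t
    unfolding E_def E'_def
    by (auto intro!: derivative_eq_intros simp: has_real_derivative_iff_has_vector_derivative[symmetric])
  have posD: "D $ j $ j > 0" and posL: "L $ j $ j > 0" for j using D L by (simp_all add: Diag_pos_def)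
  have offD: "D $ i $ j = 0" and offL: "L $ i $ j = 0" if "i \<noteq> j" for i j
    using D L that by (simp_all add: Diag_pos_def)
  have E0: "E 0 = D" using posD offD by (simp add: vec_eq_iff E)
  have E1: "E 1 = L" using posL offL by (simp add: vec_eq_iff E \<delta>_def)
  define c where "c t = (W t, E t)" for t
  have dc: "(c has_vector_derivative (W' t, E' t)) (at t)" for t
    unfolding c_def by (intro has_vector_derivative_Pair dW dE)
  have cM: "c t \<in> M" for t
    using W_orth detW by (auto simp: c_def M_def SO_def rotation_matrix_def Diag_pos_def E)
  have "continuous_on {0..1} (\<lambda>t. (W' t, E' t))"
    unfolding W'_def E'_def by (intro continuous_intros)
  then have "piecewise_C1 c"
    unfolding piecewise_C1_def
    by (intro exI[of _ 1] exI[of _ "\<lambda>i. if i = 0 then 0 else 1"])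
       (auto intro: has_vector_derivative_at_within dc)
  then have cin: "curve_in_M c" using cM by (simp add: curve_in_M_def)
  have speed: "tangent_norm k (c t) (vector_derivative c (at t)) = norm (displacement k e (U, D) (V, L))" for t
  proof -
    have "(norm (W' t))\<^sup>2 = (\<Sum>i\<in>UNIV. (\<theta> i)\<^sup>2)"
      unfolding frame_norm_matrix[OF fr, symmetric]
    proof (rule sum.cong[OF refl])
      fix i
      have "(norm (W' t *v e i))\<^sup>2 = (sin (t * \<theta> i) * \<theta> i)\<^sup>2 * (p i \<bullet> p i) + (cos (t * \<theta> i) * \<theta> i)\<^sup>2 * (q i \<bullet> q i)"
        unfolding power2_norm_eq_inner W'e
        by (simp add: inner_diff inner_add pq inner_commute[of "q i" "p i"] power2_eq_square)
      also have "\<dots> = (sin (t * \<theta> i))\<^sup>2 * (\<theta> i)\<^sup>2 + (cos (t * \<theta> i))\<^sup>2 * (\<theta> i)\<^sup>2"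
        by (cases "\<theta> i = 0") (simp_all add: pp qq power_mult_distrib)
      also have "\<dots> = ((sin (t * \<theta> i))\<^sup>2 + (cos (t * \<theta> i))\<^sup>2) * (\<theta> i)\<^sup>2"
        by (rule distrib_right[symmetric])
      finally show "(norm (W' t *v e i))\<^sup>2 = (\<theta> i)\<^sup>2" by simp
    qed
    moreover have "arccos ((U *v e i) \<bullet> (V *v e i)) = \<theta> i" for i
      using py(1)[of i i] by (simp add: \<theta>_def x_def p_def y_def)
    moreover have "tangent_norm k (c t) (W' t, E' t) \<ge> 0" by (rule tangent_norm_nonneg[OF k])
    ultimately have "(tangent_norm k (c t) (W' t, E' t))\<^sup>2 = (norm (displacement k e (U, D) (V, L)))\<^sup>2"
      using k by (simp add: norm_displacement_square tangent_norm_def c_def E E' \<delta>_def sum_nonneg)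
    then have "tangent_norm k (c t) (W' t, E' t) = norm (displacement k e (U, D) (V, L))"
      by (rule power2_eq_imp_eq[OF _ tangent_norm_nonneg[OF k] norm_ge_zero])
    then show ?thesis unfolding vector_derivative_at[OF dc] .
  qed
  have "curve_length k c = norm (displacement k e (U, D) (V, L))"
    unfolding curve_length_eq[OF cin] speed by simp
  then show thesis
    using that[OF cin] by (simp add: c_def W0 W1 E0 E1)
qed

lemma dist_M_le_displacement:
  fixes a b :: "'n::finite sqmat \<times> 'n sqmat"
  assumes k: "k \<ge> 0" and a: "a \<in> M" and b: "b \<in> M"
    and noeig: "\<And>v. v \<noteq> 0 \<Longrightarrow> (transpose (fst a) ** fst b) *v v \<noteq> - v"
    and e: "adapted_frame (transpose (fst a) ** fst b) e"
  shows "dist_M k a b \<le> norm (displacement k e a b)"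
proof -
  obtain c where "curve_in_M c" "c 0 = (fst a, snd a)" "c 1 = (fst b, snd b)"
      "curve_length k c = norm (displacement k e (fst a, snd a) (fst b, snd b))"
    using shortest_curve_exists[of k "fst a" "snd a" "fst b" "snd b" e] assms by auto
  then show ?thesis using dist_M_le_length[OF k, of c a b] by simp
qed

lemma dist_M_eq_displacement:
  fixes a b :: "'n::finite sqmat \<times> 'n sqmat"
  assumes k: "k \<ge> 0" and a: "a \<in> M" and b: "b \<in> M"
    and noeig: "\<And>v. v \<noteq> 0 \<Longrightarrow> (transpose (fst a) ** fst b) *v v \<noteq> - v"
    and e: "adapted_frame (transpose (fst a) ** fst b) e"
  shows "dist_M k a b = norm (displacement k e a b)"
proof (rule antisym)
  show "dist_M k a b \<le> norm (displacement k e a b)" by (rule dist_M_le_displacement[OF assms])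
  have fr: "orthonormal_frame e" using e by (simp add: adapted_frame_def)
  obtain c where c: "curve_in_M c" "c 0 = (fst a, snd a)" "c 1 = (fst b, snd b)"
    using shortest_curve_exists[of k "fst a" "snd a" "fst b" "snd b" e] assms by auto
  show "norm (displacement k e a b) \<le> dist_M k a b"
    unfolding dist_M_def
  proof (rule cInf_greatest)
    show "{curve_length k c |c. curve_in_M c \<and> c 0 = a \<and> c 1 = b} \<noteq> {}" using c by auto
  next
    fix l assume "l \<in> {curve_length k c |c. curve_in_M c \<and> c 0 = a \<and> c 1 = b}"
    then show "norm (displacement k e a b) \<le> l"
      using displacement_le_curve_length[OF k _ fr] by auto
  qed
qed

section \<open>Minimal pairs avoid the eigenvalue \<open>-1\<close>\<close>

lemma relative_inner: "(U *v x) \<bullet> (V *v y) = x \<bullet> ((transpose U ** V) *v y)" for U V :: "'n::finite sqmat"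
  using transpose_move[of x "transpose U" "V *v y"]
  by (simp del: transpose_matrix_vector flip: matrix_vector_mul_assoc)

lemma relative_rotation:
  assumes "a \<in> M" "b \<in> M"
  shows "rotation_matrix (transpose (fst a) ** fst b)"
  using in_M_D[OF assms(1)] in_M_D[OF assms(2)]
  by (simp add: rotation_matrix_def orthogonal_matrix_mul det_mul)

text \<open>The infimum of the empty set of reals is an unspecified number, which enters the bound for the
  distance of points that no curve joins.  The bound only serves to make the infimum
  that defines the scaling-rotation distance a lower bound.\<close>

lemma dist_M_lower:
  assumes "k \<ge> 0"
  shows "min 0 (Inf {}) \<le> dist_M k a b"
proof (cases "{curve_length k c | c. curve_in_M c \<and> c 0 = a \<and> c 1 = b} = {}")
  case True
  show ?thesis unfolding dist_M_def True by simp
next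
  case False
  then have "0 \<le> dist_M k a b"
    unfolding dist_M_def by (intro cInf_greatest) (use curve_length_nonneg[OF assms] in blast)+
  then show ?thesis by simp
qed

lemma dist_SR_le_dist_M:
  assumes "k \<ge> 0" "a \<in> fiber X" "b \<in> fiber Y"
  shows "dist_SR k X Y \<le> dist_M k a b"
  unfolding dist_SR_def
proof (rule cInf_lower)
  show "bdd_below {dist_M k a b |a b. a \<in> fiber X \<and> b \<in> fiber Y}"
    using dist_M_lower[OF assms(1)] by (intro bdd_belowI[of _ "min 0 (Inf {})"]) blast
qed (use assms in blast)

lemma fiber_sign_flip:
  assumes "a \<in> fiber X" "even (card J)"
  shows "(fst a ** sign_flip J, snd a) \<in> fiber X"
proof -
  have a: "a \<in> M" and F: "fst a ** snd a ** transpose (fst a) = X"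
    using assms(1) by (auto simp: fiber_def F_def split: prod.splits)
  have "fst a ** sign_flip J ** snd a ** transpose (fst a ** sign_flip J) =
      fst a ** (sign_flip J ** snd a ** sign_flip J) ** transpose (fst a)"
    by (simp add: matrix_transpose_mul transpose_sign_flip matrix_mul_assoc)
  also have "\<dots> = X"
    using in_M_D[OF a] F by (simp add: sign_flip_conj_diagonal)
  finally have "F (fst a ** sign_flip J, snd a) = X" by (simp add: F_def)
  moreover have "(fst a ** sign_flip J, snd a) \<in> M"
    using in_M_D[OF a] sign_flip_rotation[OF assms(2)]
    by (auto simp: M_def SO_def rotation_matrix_def orthogonal_matrix_mul det_mul)
  ultimately show ?thesis by (simp add: fiber_def)
qed

text \<open>Otherwise the displacement between the end points would have squared norm at least
  \<open>k \<pi>\<^sup>2 + \<Delta>\<close>, with \<open>\<Delta>\<close> the contribution of the diagonal parts, whereas a suitable even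
  change of signs of the columns of the first point leads to a pair in the same two fibres at a
  smaller distance.\<close>

lemma F_minimal_no_minus_eigenvector:
  fixes \<gamma> :: "real \<Rightarrow> 'n::finite sqmat \<times> 'n sqmat"
  assumes k: "k > 0" and card: "2 \<le> CARD('n)" "CARD('n) \<le> 4"
    and min: "F_minimal_geodesic k X Y \<gamma>" and w: "w \<noteq> 0"
  shows "(transpose (fst (\<gamma> 0)) ** fst (\<gamma> 1)) *v w \<noteq> - w"
proof
  define a b Q where "a = \<gamma> 0" and "b = \<gamma> 1" and "Q = transpose (fst (\<gamma> 0)) ** fst (\<gamma> 1)"
  assume "(transpose (fst (\<gamma> 0)) ** fst (\<gamma> 1)) *v w = - w"
  then have Qw: "Q *v w = - w" by (simp only: Q_def)
  have k0: "k \<ge> 0" using k by simp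
  have \<gamma>: "curve_in_M \<gamma>" and len: "curve_length k \<gamma> = dist_SR k X Y"
    and fa: "a \<in> fiber X" and fb: "b \<in> fiber Y"
    using min by (auto simp: F_minimal_geodesic_def geodesic_def a_def b_def)
  have a: "a \<in> M" and b: "b \<in> M" using fa fb by (auto simp: fiber_def)
  have rot: "rotation_matrix Q" unfolding Q_def by (rule relative_rotation) (use a b in \<open>auto simp: a_def b_def\<close>)
  define \<Delta> where "\<Delta> = (\<Sum>j\<in>UNIV. (ln (snd b $ j $ j) - ln (snd a $ j $ j))\<^sup>2)"
  obtain e where e: "adapted_frame Q e" using adapted_frame_exists .
  then have fr: "orthonormal_frame e" by (simp add: adapted_frame_def)
  define \<theta> where "\<theta> i = arccos ((fst a *v e i) \<bullet> (fst b *v e i))" for i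
  obtain i j where ij: "i \<noteq> j" "e i \<bullet> (Q *v e i) = - 1" "e j \<bullet> (Q *v e j) = - 1"
    using rotation_minus_eigenvector_two_axes[OF rot e w Qw] .
  have \<theta>ij: "\<theta> i = pi" "\<theta> j = pi"
    unfolding \<theta>_def relative_inner a_def b_def Q_def[symmetric] ij(2,3) by simp_all
  have "(\<Sum>l\<in>{i, j}. (\<theta> l)\<^sup>2) \<le> (\<Sum>l\<in>UNIV. (\<theta> l)\<^sup>2)"
    by (rule sum_mono2) auto
  then have "2 * pi\<^sup>2 \<le> (\<Sum>l\<in>UNIV. (\<theta> l)\<^sup>2)" using ij(1) \<theta>ij by simp
  then have "k / 2 * (2 * pi\<^sup>2) \<le> k / 2 * (\<Sum>l\<in>UNIV. (\<theta> l)\<^sup>2)"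
    using k by (intro mult_left_mono) auto
  then have lower: "k * pi\<^sup>2 + \<Delta> \<le> (norm (displacement k e a b))\<^sup>2"
    by (simp add: norm_displacement_square[OF k0] \<theta>_def \<Delta>_def)
  have "Q \<noteq> 0"
    using Qw w by auto
  then obtain J where J: "even (card J)" "near_identity (sign_flip J ** Q)"
    using even_sign_flip_near_identity[OF _ card] by blast
  define a' where "a' = (fst a ** sign_flip J, snd a)"
  have fa': "a' \<in> fiber X" unfolding a'_def by (rule fiber_sign_flip[OF fa J(1)])
  then have a': "a' \<in> M" by (simp add: fiber_def)
  have rel: "transpose (fst a') ** fst b = sign_flip J ** Q"
    by (simp add: a'_def matrix_transpose_mul transpose_sign_flip Q_def a_def b_def matrix_mul_assoc)
  have rot': "rotation_matrix (sign_flip J ** Q)" using relative_rotation[OF a' b] by (simp only: rel)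
  obtain e' where e': "adapted_frame (sign_flip J ** Q) e'" using adapted_frame_exists .
  have upper: "dist_M k a' b \<le> norm (displacement k e' a' b)"
    by (rule dist_M_le_displacement[OF k0 a' b]; unfold rel)
       (use near_identity_no_minus_eigenvector[OF rot' J(2)] e' in auto)
  have "k / 2 * (\<Sum>l\<in>UNIV. (arccos (e' l \<bullet> ((sign_flip J ** Q) *v e' l)))\<^sup>2) < k / 2 * (2 * pi\<^sup>2)"
    by (rule mult_strict_left_mono[OF near_identity_angles[OF rot' J(2) e']]) (use k in simp)
  then have "(norm (displacement k e' a' b))\<^sup>2 < k * pi\<^sup>2 + \<Delta>"
    unfolding norm_displacement_square[OF k0] relative_inner rel by (simp add: \<Delta>_def a'_def)
  then have "norm (displacement k e' a' b) < norm (displacement k e a b)"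
    using lower by (intro power2_less_imp_less[of "norm (displacement k e' a' b)"]) auto
  moreover have "norm (displacement k e a b) \<le> dist_SR k X Y"
    using displacement_le_curve_length[OF k0 \<gamma> fr] len by (simp add: a_def b_def)
  moreover have "dist_SR k X Y \<le> dist_M k a' b" by (rule dist_SR_le_dist_M[OF k0 fa' fb])
  ultimately show False using upper by linarith
qed

section \<open>The speed of a geodesic\<close>

lemma norm_mult_vec_le: "norm (A *v x) \<le> norm (A :: 'n::finite sqmat) * norm x"
proof (rule power2_le_imp_le)
  have "(norm (A *v x))\<^sup>2 = (\<Sum>i\<in>UNIV. (A $ i \<bullet> x)\<^sup>2)"
    by (simp add: norm_vec_square matrix_vector_mul_component)
  also have "\<dots> \<le> (\<Sum>i\<in>UNIV. (norm (A $ i))\<^sup>2 * (norm x)\<^sup>2)"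
    by (intro sum_mono) (metis Cauchy_Schwarz_ineq power2_norm_eq_inner)
  also have "\<dots> = (norm A * norm x)\<^sup>2"
    by (simp add: power_mult_distrib norm_vec_def[of A] L2_set_def sum_nonneg flip: sum_distrib_right)
  finally show "(norm (A *v x))\<^sup>2 \<le> (norm A * norm x)\<^sup>2" .
qed simp

lemma close_no_minus_eigenvector:
  fixes U V :: "'n::finite sqmat"
  assumes U: "orthogonal_matrix U" and close: "norm (U - V) < 2" and w: "w \<noteq> 0"
  shows "(transpose U ** V) *v w \<noteq> - w"
proof
  assume "(transpose U ** V) *v w = - w"
  then have "U *v ((transpose U ** V) *v w) = - (U *v w)" by (simp only: matrix_vector_minus)
  moreover have "U ** (transpose U ** V) = V" using U by (simp add: matrix_mul_assoc orthogonal_matrix_def)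
  ultimately have "V *v w = - (U *v w)" by (simp add: matrix_vector_mul_assoc)
  then have "(U - V) *v w = 2 *\<^sub>R (U *v w)"
    by (simp add: matrix_vector_mult_diff_rdistrib scaleR_2)
  then have "2 * norm w \<le> norm (U - V) * norm w"
    using norm_mult_vec_le[of "U - V" w] by (simp add: orthogonal_norm[OF U])
  then show False using close w by simp
qed

text \<open>Angles are at least as long as chords.  Unlike the displacement itself, the left-hand side
  does not depend on the frame, so it can be differentiated along a curve although the adapted
  frame changes from point to point.\<close>

lemma chord_le_displacement:
  assumes k: "k \<ge> 0" and a: "a \<in> M" and b: "b \<in> M" and e: "orthonormal_frame e"
  shows "k / 2 * (norm (fst a - fst b))\<^sup>2 + (\<Sum>j\<in>UNIV. (ln (snd b $ j $ j) - ln (snd a $ j $ j))\<^sup>2)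
    \<le> (norm (displacement k e a b))\<^sup>2"
proof -
  have "(norm (fst a - fst b))\<^sup>2 \<le> (\<Sum>i\<in>UNIV. (arccos ((fst a *v e i) \<bullet> (fst b *v e i)))\<^sup>2)"
    unfolding frame_norm_matrix[OF e, symmetric]
  proof (rule sum_mono)
    fix i
    let ?x = "fst a *v e i" and ?y = "fst b *v e i"
    have n: "norm ?x = 1" "norm ?y = 1"
      using in_M_D[OF a] in_M_D[OF b] by (simp_all add: orthogonal_norm frame_norm_one[OF e])
    have "?x \<bullet> ?x = 1" "?y \<bullet> ?y = 1" using n by (metis norm_eq_1)+
    then have "(norm ((fst a - fst b) *v e i))\<^sup>2 = 2 - 2 * (?x \<bullet> ?y)"
      by (simp add: matrix_vector_mult_diff_rdistrib power2_norm_eq_inner inner_diff inner_commute[of ?y ?x])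
    also have "\<dots> \<le> (arccos (?x \<bullet> ?y))\<^sup>2" by (rule chord_le_arccos[OF unit_inner_bound[OF n]])
    finally show "(norm ((fst a - fst b) *v e i))\<^sup>2 \<le> (arccos (?x \<bullet> ?y))\<^sup>2" .
  qed
  then show ?thesis
    using k by (simp add: norm_displacement_square mult_left_mono)
qed

text \<open>Nearby points of a curve have a relative rotation without the eigenvalue \<open>-1\<close>, so their distance is
  the norm of a displacement.\<close>

lemma geodesic_local_displacement:
  fixes \<gamma> :: "real \<Rightarrow> 'n::finite sqmat \<times> 'n sqmat"
  assumes k: "k \<ge> 0" and \<gamma>: "curve_in_M \<gamma>" and t: "t \<in> {0..1}"
    and \<epsilon>: "\<epsilon> > 0" "\<And>r s. r \<in> {0..1} \<Longrightarrow> s \<in> {0..1} \<Longrightarrow> \<bar>r - t\<bar> < \<epsilon> \<Longrightarrow> \<bar>s - t\<bar> < \<epsilon> \<Longrightarrow>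
       dist_M k (\<gamma> r) (\<gamma> s) = v * \<bar>r - s\<bar>"
  obtains \<eta> where "\<eta> > 0" "\<And>r s. r \<in> {0..1} \<Longrightarrow> s \<in> {0..1} \<Longrightarrow> \<bar>r - t\<bar> < \<eta> \<Longrightarrow> \<bar>s - t\<bar> < \<eta> \<Longrightarrow>
       \<exists>e. orthonormal_frame e \<and> v * \<bar>r - s\<bar> = norm (displacement k e (\<gamma> r) (\<gamma> s))"
proof -
  have M: "\<gamma> t \<in> M" if "t \<in> {0..1}" for t using \<gamma> that by (simp add: curve_in_M_def)
  have "continuous_on {0..1} \<gamma>" using curve_regular[OF \<gamma>] by blast
  then have "continuous_on {0..1} (\<lambda>t. fst (\<gamma> t))" by (intro continuous_intros)
  then obtain \<delta> where \<delta>: "\<delta> > 0" "\<And>s. s \<in> {0..1} \<Longrightarrow> dist s t < \<delta> \<Longrightarrow> dist (fst (\<gamma> s)) (fst (\<gamma> t)) < 1"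
    using t unfolding continuous_on_iff by (metis zero_less_one)
  show thesis
  proof (rule that[of "min \<epsilon> \<delta>"])
    fix r s assume rs: "r \<in> {0..1}" "s \<in> {0..1}" "\<bar>r - t\<bar> < min \<epsilon> \<delta>" "\<bar>s - t\<bar> < min \<epsilon> \<delta>"
    have "dist (fst (\<gamma> r)) (fst (\<gamma> t)) < 1" "dist (fst (\<gamma> s)) (fst (\<gamma> t)) < 1"
      using \<delta>(2) rs by (auto simp: dist_real_def)
    then have "norm (fst (\<gamma> r) - fst (\<gamma> s)) < 2"
      using dist_triangle2[of "fst (\<gamma> r)" "fst (\<gamma> s)" "fst (\<gamma> t)"] by (simp add: dist_norm)
    note noeig = close_no_minus_eigenvector[OF _ this]
    obtain e where e: "adapted_frame (transpose (fst (\<gamma> r)) ** fst (\<gamma> s)) e"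
      using adapted_frame_exists .
    have "dist_M k (\<gamma> r) (\<gamma> s) = norm (displacement k e (\<gamma> r) (\<gamma> s))"
      by (rule dist_M_eq_displacement[OF k M[OF rs(1)] M[OF rs(2)] noeig e]) (use in_M_D[OF M[OF rs(1)]] in auto)
    moreover have "dist_M k (\<gamma> r) (\<gamma> s) = v * \<bar>r - s\<bar>" using \<epsilon>(2) rs by simp
    ultimately show "\<exists>e. orthonormal_frame e \<and> v * \<bar>r - s\<bar> = norm (displacement k e (\<gamma> r) (\<gamma> s))"
      using e by (auto simp: adapted_frame_def)
  qed (use \<epsilon> \<delta> in auto)
qed

lemma norm_matrix_entries: "(norm (A :: 'n::finite sqmat))\<^sup>2 = (\<Sum>i\<in>UNIV. \<Sum>j\<in>UNIV. (A $ i $ j)\<^sup>2)"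
  by (simp add: norm_vec_def[of A] L2_set_def sum_nonneg norm_vec_square)

text \<open>The difference quotients of the chord length are at most \<open>v\<close>, and they converge to the
  speed.\<close>

lemma geodesic_speed_le:
  fixes \<gamma> :: "real \<Rightarrow> 'n::finite sqmat \<times> 'n sqmat"
  assumes k: "k \<ge> 0" and \<gamma>: "curve_in_M \<gamma>" and t: "t \<in> {0<..<1}" and v: "v \<ge> 0"
    and der: "(\<gamma> has_vector_derivative \<gamma>') (at t)"
    and \<eta>: "\<eta> > 0" "\<And>r s. r \<in> {0..1} \<Longrightarrow> s \<in> {0..1} \<Longrightarrow> \<bar>r - t\<bar> < \<eta> \<Longrightarrow> \<bar>s - t\<bar> < \<eta> \<Longrightarrow>
       \<exists>e. orthonormal_frame e \<and> v * \<bar>r - s\<bar> = norm (displacement k e (\<gamma> r) (\<gamma> s))"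
  shows "tangent_norm k (\<gamma> t) \<gamma>' \<le> v"
proof -
  have M: "\<gamma> t \<in> M" if "t \<in> {0..1}" for t using \<gamma> that by (simp add: curve_in_M_def)
  have t01: "t \<in> {0..1}" using t by auto
  have pos: "snd (\<gamma> t) $ j $ j > 0" for j using in_M_D[OF M[OF t01]] by (simp add: Diag_pos_def)
  have dU: "((\<lambda>s. fst (\<gamma> s) $ i $ j) has_real_derivative fst \<gamma>' $ i $ j) (at t)" for i j
    using bounded_linear.has_vector_derivative[OF bounded_linear_compose[OF bounded_linear_entry bounded_linear_fst] der]
    by (simp add: has_real_derivative_iff_has_vector_derivative)
  have dD: "((\<lambda>s. snd (\<gamma> s) $ i $ j) has_real_derivative snd \<gamma>' $ i $ j) (at t)" for i j
    using bounded_linear.has_vector_derivative[OF bounded_linear_compose[OF bounded_linear_entry bounded_linear_snd] der]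
    by (simp add: has_real_derivative_iff_has_vector_derivative)
  have dln: "((\<lambda>s. ln (snd (\<gamma> s) $ j $ j)) has_real_derivative
      snd \<gamma>' $ j $ j / snd (\<gamma> t) $ j $ j) (at t)" for j
    by (rule DERIV_cong[OF DERIV_chain2[OF DERIV_ln[OF pos] dD]]) (simp add: divide_inverse mult.commute)
  define g where "g s = k / 2 * (\<Sum>i\<in>UNIV. \<Sum>j\<in>UNIV. ((fst (\<gamma> s) $ i $ j - fst (\<gamma> t) $ i $ j) / (s - t))\<^sup>2) +
      (\<Sum>j\<in>UNIV. ((ln (snd (\<gamma> s) $ j $ j) - ln (snd (\<gamma> t) $ j $ j)) / (s - t))\<^sup>2)" for s
  have lim: "(g \<longlongrightarrow> k / 2 * (\<Sum>i\<in>UNIV. \<Sum>j\<in>UNIV. (fst \<gamma>' $ i $ j)\<^sup>2) +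
      (\<Sum>j\<in>UNIV. (snd \<gamma>' $ j $ j / snd (\<gamma> t) $ j $ j)\<^sup>2)) (at t)"
    unfolding g_def
    by (intro tendsto_intros dU[unfolded has_field_derivative_iff] dln[unfolded has_field_derivative_iff])
  have g_le: "g s \<le> v\<^sup>2" if s: "s \<in> {0..1}" "\<bar>s - t\<bar> < \<eta>" "s \<noteq> t" for s
  proof -
    obtain e where e: "orthonormal_frame e" "v * \<bar>t - s\<bar> = norm (displacement k e (\<gamma> t) (\<gamma> s))"
      using \<eta>(2)[OF t01 s(1) _ s(2)] \<eta>(1) by auto
    have pos2: "(s - t)\<^sup>2 > 0" using s(3) by simp
    have "g s = (k / 2 * (norm (fst (\<gamma> t) - fst (\<gamma> s)))\<^sup>2 +
        (\<Sum>j\<in>UNIV. (ln (snd (\<gamma> s) $ j $ j) - ln (snd (\<gamma> t) $ j $ j))\<^sup>2)) / (s - t)\<^sup>2"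
      unfolding g_def norm_minus_commute[of "fst (\<gamma> t)"] norm_matrix_entries power_divide
        sum_divide_distrib[symmetric]
      by (simp add: add_divide_distrib)
    then have "g s * (s - t)\<^sup>2 = k / 2 * (norm (fst (\<gamma> t) - fst (\<gamma> s)))\<^sup>2 +
        (\<Sum>j\<in>UNIV. (ln (snd (\<gamma> s) $ j $ j) - ln (snd (\<gamma> t) $ j $ j))\<^sup>2)"
      using s(3) by simp
    also have "\<dots> \<le> (v * \<bar>t - s\<bar>)\<^sup>2"
      unfolding e(2) by (rule chord_le_displacement[OF k M[OF t01] M[OF s(1)] e(1)])
    also have "\<dots> = v\<^sup>2 * (s - t)\<^sup>2" by (simp add: power_mult_distrib power2_commute)
    finally show ?thesis using pos2 by simp
  qed
  have "\<forall>\<^sub>F s in at t. g s \<le> v\<^sup>2"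
    unfolding eventually_at
  proof (intro exI[of _ "min \<eta> (min t (1 - t))"] conjI ballI impI)
    fix s assume "s \<noteq> t \<and> dist s t < min \<eta> (min t (1 - t))"
    then show "g s \<le> v\<^sup>2"
      by (intro g_le) (auto simp: dist_real_def abs_less_iff)
  qed (use t \<eta>(1) in auto)
  with lim have "k / 2 * (\<Sum>i\<in>UNIV. \<Sum>j\<in>UNIV. (fst \<gamma>' $ i $ j)\<^sup>2) +
      (\<Sum>j\<in>UNIV. (snd \<gamma>' $ j $ j / snd (\<gamma> t) $ j $ j)\<^sup>2) \<le> v\<^sup>2"
    by (rule tendsto_upperbound) simp
  then show ?thesis
    using v unfolding tangent_norm_def norm_matrix_entries by (intro real_le_lsqrt) auto
qed

text \<open>The constant \<open>v\<close> in the definition of a geodesic bounds the speed from above; and \<open>v\<close> is at most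
  the total length, because the lower bound for lengths shows this on all short
  intervals and both sides are additive.\<close>

lemma geodesic_length:
  fixes \<gamma> :: "real \<Rightarrow> 'n::finite sqmat \<times> 'n sqmat"
  assumes k: "k \<ge> 0" and geo: "geodesic k \<gamma>"
  obtains v where "v \<ge> 0" "v \<le> curve_length k \<gamma>"
    "\<And>r s. 0 \<le> r \<Longrightarrow> r \<le> s \<Longrightarrow> s \<le> 1 \<Longrightarrow>
      integral {r..s} (\<lambda>t. tangent_norm k (\<gamma> t) (vector_derivative \<gamma> (at t))) \<le> v * (s - r)"
proof -
  let ?\<sigma> = "\<lambda>t. tangent_norm k (\<gamma> t) (vector_derivative \<gamma> (at t))"
  obtain v where \<gamma>: "curve_in_M \<gamma>" and v: "v \<ge> 0"
    and loc: "\<And>t. t \<in> {0..1} \<Longrightarrow> \<exists>\<epsilon>>0. \<forall>r \<in> {0..1}. \<forall>s \<in> {0..1}.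
       \<bar>r - t\<bar> < \<epsilon> \<and> \<bar>s - t\<bar> < \<epsilon> \<longrightarrow> dist_M k (\<gamma> r) (\<gamma> s) = v * \<bar>r - s\<bar>"
    using geo unfolding geodesic_def by blast
  have disp: "\<exists>\<eta>>0. \<forall>r s. r \<in> {0..1} \<longrightarrow> s \<in> {0..1} \<longrightarrow> \<bar>r - t\<bar> < \<eta> \<longrightarrow> \<bar>s - t\<bar> < \<eta> \<longrightarrow>
       (\<exists>e. orthonormal_frame e \<and> v * \<bar>r - s\<bar> = norm (displacement k e (\<gamma> r) (\<gamma> s)))"
    if t: "t \<in> {0..1}" for t
  proof -
    obtain \<epsilon> where \<epsilon>: "\<epsilon> > 0" "\<And>r s. r \<in> {0..1} \<Longrightarrow> s \<in> {0..1} \<Longrightarrow> \<bar>r - t\<bar> < \<epsilon> \<Longrightarrow> \<bar>s - t\<bar> < \<epsilon> \<Longrightarrow>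
       dist_M k (\<gamma> r) (\<gamma> s) = v * \<bar>r - s\<bar>"
      using loc[OF t] by blast
    show ?thesis
    proof (rule geodesic_local_displacement[OF k \<gamma> t \<epsilon>(1), where v = v])
      show "dist_M k (\<gamma> r) (\<gamma> s) = v * \<bar>r - s\<bar>"
        if "r \<in> {0..1}" "s \<in> {0..1}" "\<bar>r - t\<bar> < \<epsilon>" "\<bar>s - t\<bar> < \<epsilon>" for r s
        by (rule \<epsilon>(2)[OF that])
    qed blast
  qed
  obtain K where K: "finite K"
    "\<And>t. t \<in> {0<..<1} - K \<Longrightarrow> (\<gamma> has_vector_derivative vector_derivative \<gamma> (at t)) (at t)"
    "?\<sigma> integrable_on {0..1}"
    using curve_regular[OF \<gamma>, of k] by blast
  have int: "?\<sigma> integrable_on {r..s}" if "0 \<le> r" "s \<le> 1" for r s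
    by (rule integrable_subinterval_real[OF K(3)]) (use that in auto)
  have speed: "?\<sigma> t \<le> v" if "t \<in> {0<..<1} - K" for t
  proof -
    have "t \<in> {0..1}" "t \<in> {0<..<1}" using that by auto
    from disp[OF this(1)] obtain \<eta> where \<eta>: "\<eta> > 0" "\<And>r s. r \<in> {0..1} \<Longrightarrow> s \<in> {0..1} \<Longrightarrow> \<bar>r - t\<bar> < \<eta> \<Longrightarrow> \<bar>s - t\<bar> < \<eta> \<Longrightarrow>
       \<exists>e. orthonormal_frame e \<and> v * \<bar>r - s\<bar> = norm (displacement k e (\<gamma> r) (\<gamma> s))"
      by blast
    show ?thesis
      by (rule geodesic_speed_le[OF k \<gamma> \<open>t \<in> {0<..<1}\<close> v K(2)[OF that] \<eta>(1)]) (rule \<eta>(2); assumption)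
  qed
  have upper: "integral {r..s} ?\<sigma> \<le> v * (s - r)" if rs: "0 \<le> r" "r \<le> s" "s \<le> 1" for r s
  proof -
    let ?N = "insert 0 (insert 1 K)"
    define \<sigma>' where "\<sigma>' t = (if t \<in> ?N then v else ?\<sigma> t)" for t
    have "negligible ?N" using K(1) by (intro negligible_finite) simp
    then have "(\<sigma>' has_integral integral {r..s} ?\<sigma>) {r..s}"
      by (rule has_integral_spike[OF _ _ integrable_integral[OF int[OF rs(1,3)]]]) (simp add: \<sigma>'_def)
    moreover have "((\<lambda>_. v) has_integral v * (s - r)) {r..s}"
      using has_integral_const_real[of v r s] rs by (simp add: mult.commute)
    moreover have "\<sigma>' t \<le> v" if "t \<in> {r..s}" for t
      using speed[of t] that rs by (auto simp: \<sigma>'_def)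
    ultimately show ?thesis by (rule has_integral_le)
  qed
  have "0 \<le> (0::real) \<longrightarrow> 1 \<le> (1::real) \<longrightarrow> v * (1 - 0) \<le> integral {0..1} ?\<sigma>"
  proof (rule Bolzano[of 0 1 "\<lambda>r s. 0 \<le> r \<longrightarrow> s \<le> 1 \<longrightarrow> v * (s - r) \<le> integral {r..s} ?\<sigma>"])
    fix p q r :: real
    assume A: "0 \<le> p \<longrightarrow> q \<le> 1 \<longrightarrow> v * (q - p) \<le> integral {p..q} ?\<sigma>"
       "0 \<le> q \<longrightarrow> r \<le> 1 \<longrightarrow> v * (r - q) \<le> integral {q..r} ?\<sigma>" "p \<le> q" "q \<le> r"
    show "0 \<le> p \<longrightarrow> r \<le> 1 \<longrightarrow> v * (r - p) \<le> integral {p..r} ?\<sigma>"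
    proof (intro impI)
      assume "0 \<le> p" "r \<le> 1"
      moreover have "integral {p..q} ?\<sigma> + integral {q..r} ?\<sigma> = integral {p..r} ?\<sigma>"
        by (rule Henstock_Kurzweil_Integration.integral_combine[OF A(3,4) int[OF \<open>0 \<le> p\<close> \<open>r \<le> 1\<close>]])
      ultimately show "v * (r - p) \<le> integral {p..r} ?\<sigma>" using A by (simp add: algebra_simps)
    qed
  next
    fix t :: real assume "0 \<le> t" "t \<le> 1"
    then have "t \<in> {0..1}" by simp
    from disp[OF this] obtain \<eta> where \<eta>: "\<eta> > 0" "\<And>r s. r \<in> {0..1} \<Longrightarrow> s \<in> {0..1} \<Longrightarrow> \<bar>r - t\<bar> < \<eta> \<Longrightarrow> \<bar>s - t\<bar> < \<eta> \<Longrightarrow>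
       \<exists>e. orthonormal_frame e \<and> v * \<bar>r - s\<bar> = norm (displacement k e (\<gamma> r) (\<gamma> s))"
      by blast
    show "\<exists>d>0. \<forall>r s. r \<le> t \<and> t \<le> s \<and> s - r < d \<longrightarrow> 0 \<le> r \<longrightarrow> s \<le> 1 \<longrightarrow> v * (s - r) \<le> integral {r..s} ?\<sigma>"
    proof (intro exI[of _ \<eta>] conjI allI impI \<eta>(1))
      fix r s :: real assume rs: "r \<le> t \<and> t \<le> s \<and> s - r < \<eta>" "0 \<le> r" "s \<le> 1"
      then obtain e where e: "orthonormal_frame e" "v * \<bar>r - s\<bar> = norm (displacement k e (\<gamma> r) (\<gamma> s))"
        using \<eta>(2)[of r s] by auto
      then show "v * (s - r) \<le> integral {r..s} ?\<sigma>"
        using displacement_le_length[OF k \<gamma> rs(2) _ rs(3) e(1)] rs by simp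
    qed
  qed simp
  then have "v \<le> curve_length k \<gamma>" by (simp add: curve_length_eq[OF \<gamma>])
  then show thesis using that v upper by blast
qed

section \<open>Uniqueness of minimal geodesics\<close>

text \<open>Strict convexity of the norm: both inequalities of Cauchy--Schwarz must be equalities.\<close>

lemma proportional_parts:
  fixes p q z :: "'a::real_inner"
  assumes t: "0 \<le> t" "t \<le> 1" and p: "norm p \<le> t * norm z" and q: "norm q \<le> (1 - t) * norm z"
    and pq: "z \<bullet> z \<le> (p + q) \<bullet> z"
  shows "p = t *\<^sub>R z" "q = (1 - t) *\<^sub>R z"
proof -
  have eq: "x = s *\<^sub>R z" if "norm x \<le> s * norm z" "s * (z \<bullet> z) \<le> x \<bullet> z" for x s
  proof -
    have "(norm x)\<^sup>2 \<le> (s * norm z)\<^sup>2" using that(1) by (intro power_mono) auto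
    then have "x \<bullet> x \<le> s\<^sup>2 * (z \<bullet> z)" by (simp add: power_mult_distrib power2_norm_eq_inner)
    moreover have "s \<ge> 0 \<or> z = 0" using that(1) norm_ge_zero[of x] by (smt (verit) mult_neg_pos zero_less_norm_iff)
    moreover have "(norm (x - s *\<^sub>R z))\<^sup>2 = x \<bullet> x - 2 * s * (x \<bullet> z) + s\<^sup>2 * (z \<bullet> z)"
      by (simp only: power2_norm_eq_inner)
         (simp add: inner_diff inner_commute[of z x] power2_eq_square algebra_simps)
    moreover have "s * (s * (z \<bullet> z)) \<le> s * (x \<bullet> z)" if "s \<ge> 0"
      using \<open>s * (z \<bullet> z) \<le> x \<bullet> z\<close> that by (rule mult_left_mono)
    ultimately have "(norm (x - s *\<^sub>R z))\<^sup>2 \<le> 0"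
      by (auto simp: power2_eq_square mult.assoc)
    then show ?thesis by simp
  qed
  have "p \<bullet> z \<le> t * (z \<bullet> z)"
    using norm_cauchy_schwarz[of p z] mult_right_mono[OF p, of "norm z"]
    by (simp add: power2_norm_eq_inner[symmetric] power2_eq_square mult.assoc)
  moreover have "q \<bullet> z \<le> (1 - t) * (z \<bullet> z)"
    using norm_cauchy_schwarz[of q z] mult_right_mono[OF q, of "norm z"]
    by (simp add: power2_norm_eq_inner[symmetric] power2_eq_square mult.assoc)
  ultimately have "t * (z \<bullet> z) \<le> p \<bullet> z" "(1 - t) * (z \<bullet> z) \<le> q \<bullet> z"
    using pq by (simp_all add: inner_add_left algebra_simps)
  then show "p = t *\<^sub>R z" "q = (1 - t) *\<^sub>R z" using eq p q by blast+
qed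

text \<open>The angles satisfy the triangle inequality on the sphere, and the logarithmic components
  are additive.\<close>

lemma displacement_triangle:
  fixes a b c :: "'n::finite sqmat \<times> 'n sqmat"
  assumes k: "k \<ge> 0" and a: "a \<in> M" and b: "b \<in> M" and c: "c \<in> M" and e: "orthonormal_frame e"
  shows "displacement k e a c \<bullet> displacement k e a c \<le>
    (displacement k e a b + displacement k e b c) \<bullet> displacement k e a c"
proof -
  have n: "norm (fst x *v e i) = 1" if "x \<in> M" for x i
    using in_M_D[OF that] by (simp add: orthogonal_norm frame_norm_one[OF e])
  define al where "al x y i = arccos ((fst x *v e i) \<bullet> (fst y *v e i))"
    for x y :: "'n sqmat \<times> 'n sqmat" and i
  have tri: "al a c i \<le> al a b i + al b c i" for i
    unfolding al_def by (rule sphere_triangle[OF n[OF a] n[OF b] n[OF c]])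
  have nn: "al a c i \<ge> 0" for i
    unfolding al_def using unit_inner_bound[OF n[OF a] n[OF c], of i i] by (intro arccos_lbound) auto
  have "(sqrt (k / 2) * al a c i) * (sqrt (k / 2) * al a c i)
      \<le> (sqrt (k / 2) * al a b i + sqrt (k / 2) * al b c i) * (sqrt (k / 2) * al a c i)" for i
    using tri[of i] nn[of i] k
    by (intro mult_right_mono) (simp_all add: mult_left_mono flip: distrib_left)
  then show ?thesis
    unfolding displacement_def al_def[symmetric]
    unfolding inner_Pair add_Pair inner_vec_def inner_real_def
    by (intro add_mono sum_mono) (simp_all add: distrib_right)
qed

text \<open>The two parts of a minimal geodesic have lengths at most \<open>t * norm z\<close> and
  \<open>(1 - t) * norm z\<close>, with \<open>z\<close> the displacement between the end points, because its speed does not exceed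
  the distance of the end points.\<close>

lemma F_minimal_geodesic_position:
  fixes \<gamma> :: "real \<Rightarrow> 'n::finite sqmat \<times> 'n sqmat"
  assumes k: "k \<ge> 0" and min: "F_minimal_geodesic k X Y \<gamma>" and t: "0 \<le> t" "t \<le> 1"
    and noeig: "\<And>w. w \<noteq> 0 \<Longrightarrow> (transpose (fst (\<gamma> 0)) ** fst (\<gamma> 1)) *v w \<noteq> - w"
    and e: "adapted_frame (transpose (fst (\<gamma> 0)) ** fst (\<gamma> 1)) e"
  shows "displacement k e (\<gamma> 0) (\<gamma> t) = t *\<^sub>R displacement k e (\<gamma> 0) (\<gamma> 1)"
    and "displacement k e (\<gamma> t) (\<gamma> 1) = (1 - t) *\<^sub>R displacement k e (\<gamma> 0) (\<gamma> 1)"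
proof -
  have fr: "orthonormal_frame e" using e by (simp add: adapted_frame_def)
  have geo: "geodesic k \<gamma>" and \<gamma>: "curve_in_M \<gamma>" and fa: "\<gamma> 0 \<in> fiber X" and fb: "\<gamma> 1 \<in> fiber Y"
    and len: "curve_length k \<gamma> = dist_SR k X Y"
    using min by (auto simp: F_minimal_geodesic_def geodesic_def)
  have M: "\<gamma> t \<in> M" if "t \<in> {0..1}" for t using \<gamma> that by (simp add: curve_in_M_def)
  let ?z = "displacement k e (\<gamma> 0) (\<gamma> 1)"
  obtain v where v: "v \<ge> 0" "v \<le> curve_length k \<gamma>"
    "\<And>r s. 0 \<le> r \<Longrightarrow> r \<le> s \<Longrightarrow> s \<le> 1 \<Longrightarrow>
      integral {r..s} (\<lambda>t. tangent_norm k (\<gamma> t) (vector_derivative \<gamma> (at t))) \<le> v * (s - r)"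
    using geodesic_length[OF k geo] by blast
  have "dist_M k (\<gamma> 0) (\<gamma> 1) \<le> norm ?z"
    by (rule dist_M_le_displacement[OF k M M noeig e]) auto
  then have vz: "v \<le> norm ?z" using v(2) len dist_SR_le_dist_M[OF k fa fb] by linarith
  have part: "norm (displacement k e (\<gamma> r) (\<gamma> s)) \<le> (s - r) * norm ?z" if rs: "0 \<le> r" "r \<le> s" "s \<le> 1" for r s
  proof -
    have "norm (displacement k e (\<gamma> r) (\<gamma> s)) \<le> v * (s - r)"
      using displacement_le_length[OF k \<gamma> rs fr] v(3)[OF rs] by linarith
    also have "\<dots> \<le> norm ?z * (s - r)" using vz rs by (intro mult_right_mono) auto
    finally show ?thesis by (simp add: mult.commute)
  qed
  have p: "norm (displacement k e (\<gamma> 0) (\<gamma> t)) \<le> t * norm ?z" using part[of 0 t] t by simp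
  have q: "norm (displacement k e (\<gamma> t) (\<gamma> 1)) \<le> (1 - t) * norm ?z" using part[of t 1] t by simp
  have "?z \<bullet> ?z \<le> (displacement k e (\<gamma> 0) (\<gamma> t) + displacement k e (\<gamma> t) (\<gamma> 1)) \<bullet> ?z"
    by (rule displacement_triangle[OF k M M M fr]) (use t in auto)
  note * = proportional_parts[OF t p q this]
  show "displacement k e (\<gamma> 0) (\<gamma> t) = t *\<^sub>R ?z" by (rule *(1))
  show "displacement k e (\<gamma> t) (\<gamma> 1) = (1 - t) *\<^sub>R ?z" by (rule *(2))
qed

lemma displacement_log_component:
  assumes "displacement k e a b = displacement k e a' b'"
  shows "ln (snd b $ j $ j) - ln (snd a $ j $ j) = ln (snd b' $ j $ j) - ln (snd a' $ j $ j)"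
  using assms by (auto simp: displacement_def vec_eq_iff)

text \<open>The displacements of \<open>\<gamma> t\<close> from the two end points are known, hence so are the angles of each
  \<open>U e i\<close> with its initial and final positions, which are not antipodal, and the logarithms of the
  diagonal entries.\<close>

lemma F_minimal_geodesic_unique:
  fixes \<gamma>1 \<gamma>2 :: "real \<Rightarrow> 'n::finite sqmat \<times> 'n sqmat"
  assumes k: "k > 0" and card: "2 \<le> CARD('n)" "CARD('n) \<le> 4"
    and min1: "F_minimal_geodesic k X Y \<gamma>1" and min2: "F_minimal_geodesic k X Y \<gamma>2"
    and ends: "\<gamma>1 0 = \<gamma>2 0" "\<gamma>1 1 = \<gamma>2 1" and t: "t \<in> {0..1}"
  shows "\<gamma>1 t = \<gamma>2 t"
proof -
  have k0: "k \<ge> 0" using k by simp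
  have t01: "0 \<le> t" "t \<le> 1" using t by auto
  define a b where "a = \<gamma>1 0" and "b = \<gamma>1 1"
  define Q where "Q = transpose (fst a) ** fst b"
  have noeig: "Q *v w \<noteq> - w" if "w \<noteq> 0" for w
    using F_minimal_no_minus_eigenvector[OF k card min1 that] unfolding Q_def a_def b_def .
  obtain e where e: "adapted_frame Q e" using adapted_frame_exists .
  then have fr: "orthonormal_frame e" by (simp add: adapted_frame_def)
  have a2: "\<gamma>2 0 = a" and b2: "\<gamma>2 1 = b" using ends by (simp_all add: a_def b_def)
  have M1: "\<gamma>1 s \<in> M" and M2: "\<gamma>2 s \<in> M" if "s \<in> {0..1}" for s
    using min1 min2 that by (auto simp: F_minimal_geodesic_def geodesic_def curve_in_M_def)
  have aM: "a \<in> M" and bM: "b \<in> M" using M1[of 0] M1[of 1] by (auto simp: a_def b_def)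
  have pos1: "displacement k e a (\<gamma>1 t) = t *\<^sub>R displacement k e a b"
    "displacement k e (\<gamma>1 t) b = (1 - t) *\<^sub>R displacement k e a b"
    using F_minimal_geodesic_position[OF k0 min1 t01, folded a_def b_def, folded Q_def, OF noeig e] by blast+
  have pos2: "displacement k e a (\<gamma>2 t) = t *\<^sub>R displacement k e a b"
    "displacement k e (\<gamma>2 t) b = (1 - t) *\<^sub>R displacement k e a b"
    using F_minimal_geodesic_position[OF k0 min2 t01, unfolded a2 b2, folded Q_def, OF noeig e] by blast+
  define \<theta> where "\<theta> i = arccos ((fst a *v e i) \<bullet> (fst b *v e i))" for i
  have n: "norm (fst x *v e i) = 1" if "x \<in> M" for x i
    using in_M_D[OF that] by (simp add: orthogonal_norm frame_norm_one[OF fr])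
  have angle: "(fst x *v e i) \<bullet> (fst y *v e i) = cos (s * \<theta> i)"
    if "x \<in> M" "y \<in> M" "displacement k e x y = s *\<^sub>R displacement k e a b" for x y s i
  proof -
    have "arccos ((fst x *v e i) \<bullet> (fst y *v e i)) = s * \<theta> i"
      using that(3) k by (auto simp: displacement_def vec_eq_iff \<theta>_def)
    then show ?thesis
      using cos_arccos_abs[OF unit_inner_bound[OF n[OF that(1)] n[OF that(2)], of i i]] by simp
  qed
  have "fst (\<gamma>1 t) = fst (\<gamma>2 t)"
  proof (rule frame_matrix_eqI[OF fr])
    fix i
    have x: "(fst a *v e i) \<bullet> (fst b *v e i) = cos (\<theta> i)"
      using angle[OF aM bM, of 1 i] by simp
    have "\<theta> i \<noteq> pi"
    proof
      assume "\<theta> i = pi"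
      then have "e i \<bullet> (Q *v e i) = - 1" using x unfolding relative_inner Q_def by simp
      moreover have "norm (Q *v e i) = 1"
        using relative_rotation[OF aM bM] by (simp add: Q_def rotation_matrix_def orthogonal_norm frame_norm_one[OF fr])
      ultimately have "Q *v e i = - e i"
        using unit_inner_minus_one_imp_eq[OF frame_norm_one[OF fr]] by blast
      moreover have "e i \<noteq> 0" using frame_norm_one[OF fr, of i] by auto
      ultimately show False using noeig by blast
    qed
    moreover have "0 \<le> \<theta> i" "\<theta> i \<le> pi"
      unfolding \<theta>_def using unit_inner_bound[OF n[OF aM] n[OF bM], of i i]
      by (auto intro!: arccos_lbound arccos_ubound)
    ultimately have \<theta>: "0 \<le> \<theta> i" "\<theta> i < pi" by auto
    show "fst (\<gamma>1 t) *v e i = fst (\<gamma>2 t) *v e i"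
      by (rule slerp_unique[OF n[OF aM] n[OF M1[OF t]] n[OF M2[OF t]] n[OF bM] \<theta> x])
         (rule angle[OF aM M1[OF t] pos1(1)] angle[OF M1[OF t] bM pos1(2)]
           angle[OF aM M2[OF t] pos2(1)] angle[OF M2[OF t] bM pos2(2)])+
  qed
  moreover have "snd (\<gamma>1 t) = snd (\<gamma>2 t)"
  proof -
    have D: "snd (\<gamma>1 t) \<in> Diag_pos" "snd (\<gamma>2 t) \<in> Diag_pos" using in_M_D[OF M1[OF t]] in_M_D[OF M2[OF t]] by auto
    have "snd (\<gamma>1 t) $ i $ j = snd (\<gamma>2 t) $ i $ j" for i j
    proof (cases "i = j")
      case True
      have "ln (snd (\<gamma>1 t) $ i $ i) = ln (snd (\<gamma>2 t) $ i $ i)"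
        using displacement_log_component[OF trans[OF pos1(1) pos2(1)[symmetric]], of i] by simp
      then show ?thesis using D True by (simp add: Diag_pos_def ln_inj_iff)
    next
      case False
      then show ?thesis using D by (simp add: Diag_pos_def)
    qed
    then show ?thesis by (simp add: vec_eq_iff)
  qed
  ultimately show ?thesis by (simp add: prod_eq_iff)
qed

section \<open>Minimal pairs and non-uniqueness in dimensions two to four\<close>

theorem corollary3p19:
  fixes k :: real
  assumes "k > 0" and "2 \<le> CARD('n::finite)" and "CARD('n) \<le> 4"
  shows "(\<forall>a b :: 'n sqmat \<times> 'n sqmat. minimal_pair k a b \<longrightarrow> \<not> geodesically_antipodal a b) \<and>
    (\<forall>X \<in> (Sym_pos :: 'n sqmat set). \<forall>Y \<in> Sym_pos.
       (\<exists>\<chi>1 \<in> MSSR k X Y. \<exists>\<chi>2 \<in> MSSR k X Y. \<chi>1 \<noteq> \<chi>2) \<longrightarrow>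
         type_I_nonuniqueness k X Y \<and> \<not> type_II_nonuniqueness k X Y)"
proof (intro conjI allI impI ballI)
  fix a b :: "'n sqmat \<times> 'n sqmat"
  assume "minimal_pair k a b"
  then obtain X Y \<gamma> where min: "F_minimal_geodesic k X Y \<gamma>" and ab: "a = \<gamma> 0" "b = \<gamma> 1"
    unfolding minimal_pair_def by blast
  show "\<not> geodesically_antipodal a b"
  proof
    assume "geodesically_antipodal a b"
    then have inv: "is_involution (matrix_inv (fst b) ** fst a)"
      by (simp add: geodesically_antipodal_def split: prod.splits)
    have M: "a \<in> M" "b \<in> M"
      using min by (auto simp: F_minimal_geodesic_def fiber_def ab)
    define R Q where "R = transpose (fst b) ** fst a" and "Q = transpose (fst a) ** fst b"
    have R: "R ** R = mat 1" "R \<noteq> mat 1"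
      using inv in_M_D[OF M(2)] by (simp_all add: is_involution_def matrix_inv_orthogonal R_def)
    have "transpose R = Q" by (simp add: R_def Q_def matrix_transpose_mul)
    moreover have "orthogonal_matrix R"
      using relative_rotation[OF M(2,1)] by (simp add: R_def rotation_matrix_def)
    ultimately have "Q ** R = mat 1" by (simp add: orthogonal_matrix_def)
    then have "Q = R" using R(1) by (metis matrix_mul_assoc matrix_mul_lid matrix_mul_rid)
    obtain x where "R *v x \<noteq> mat 1 *v x" using R(2) by (metis matrix_eq)
    then have "x - R *v x \<noteq> 0" by simp
    moreover have "R *v (x - R *v x) = - (x - R *v x)"
      using R(1) by (simp add: matrix_vector_mult_diff_distrib matrix_vector_mul_assoc)
    ultimately show False
      using F_minimal_no_minus_eigenvector[OF assms min, of "x - R *v x"] \<open>Q = R\<close>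
      by (simp add: Q_def ab)
  qed
next
  fix X Y :: "'n sqmat"
  assume nonunique: "\<exists>\<chi>1 \<in> MSSR k X Y. \<exists>\<chi>2 \<in> MSSR k X Y. \<chi>1 \<noteq> \<chi>2"
  have same: "SR_curve \<gamma>1 = SR_curve \<gamma>2"
    if "F_minimal_geodesic k X Y \<gamma>1" "F_minimal_geodesic k X Y \<gamma>2" "(\<gamma>1 0, \<gamma>1 1) = (\<gamma>2 0, \<gamma>2 1)"
    for \<gamma>1 \<gamma>2
    unfolding SR_curve_def
    by (rule restrict_ext) (use F_minimal_geodesic_unique[OF assms that(1,2)] that(3) in auto)
  show "\<not> type_II_nonuniqueness k X Y"
    using same unfolding type_II_nonuniqueness_def by blast
  obtain \<gamma>1 \<gamma>2 where "F_minimal_geodesic k X Y \<gamma>1" "F_minimal_geodesic k X Y \<gamma>2" "SR_curve \<gamma>1 \<noteq> SR_curve \<gamma>2"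
    using nonunique unfolding MSSR_def by blast
  then show "type_I_nonuniqueness k X Y"
    using same unfolding type_I_nonuniqueness_def by blast
qed

end
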